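(* Let $Y$ be a reflexive real Banach space with the approximation property, and suppose $y_0^*\in S_{Y^*}$ is a unitary (of $Y^*$). Then for any real Banach space $X$ such that $\mathcal{L}(X,Y^* )=\mathcal{K}(X,Y^* )$ and any Namioka point $x_0^*\in S_{X^*}$ of $B_{X^*}$, the operator $x_0^*\otimes y_0^*\in S_{\mathcal{L}(X,Y^* )}$ is a Namioka point of $B_{\mathcal{L}(X,Y^* )}$.
   Context: $B_Z$ and $S_Z$ denote the closed unit ball and unit sphere of a Banach space $Z$. An element $z_0\in S_Z$ is a unitary (of $Z$) if $Z^*=\operatorname{span}\{z^*\in B_{Z^*}: z^*(z_0)=1\}$ (linear span). A point $z_0^*\in B_{Z^*}$ is a Namioka point of $B_{Z^*}$ if the identity map $(B_{Z^*},\text{weak}^* )\to(B_{Z^*},\text{weak})$ is continuous at $z_0^*$, where the weak topology on $Z^*$ is the one induced by $Z^{**}$. $\mathcal{L}(X,Y^* )$ and $\mathcal{K}(X,Y^* )$ are the spaces of bounded, respectively compact, linear operators from $X$ to $Y^*$ with the operator norm. $\mathcal{L}(X,Y^* )$ is identified isometrically with the dual of the projective tensor product $X\hat{\otimes}_\pi Y$ via $T(x\otimes y)=(Tx)(y)$, and its weak$^*$-topology is always the one coming from this predual. $x_0^*\otimes y_0^*$ is the operator $x\mapsto x_0^*(x)\,y_0^*$. *)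

theory Defs
  imports "HOL-Analysis.Analysis"
begin

text \<open>Banach spaces are types of class \<^class>\<open>banach\<close>; the dual of \<open>'a\<close> is
  \<open>'a \<Rightarrow>\<^sub>L real\<close>, and \<open>\<L>(X, Y\<^sup>*)\<close> is \<open>'x \<Rightarrow>\<^sub>L ('y \<Rightarrow>\<^sub>L real)\<close>.\<close>

section \<open>Reflexivity, approximation property, compact operators, unitaries\<close>

lift_definition bidual_embedding ::
  "'a::real_normed_vector \<Rightarrow> ('a \<Rightarrow>\<^sub>L real) \<Rightarrow>\<^sub>L real"
  is "\<lambda>x f. blinfun_apply f x"
  by (rule blinfun.bounded_linear_left)

definition reflexive_space :: "'a::real_normed_vector itself \<Rightarrow> bool" where
  "reflexive_space _ \<longleftrightarrow> surj (bidual_embedding :: 'a \<Rightarrow> ('a \<Rightarrow>\<^sub>L real) \<Rightarrow>\<^sub>L real)"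

definition finite_rank :: "('a::real_normed_vector \<Rightarrow>\<^sub>L 'b::real_normed_vector) \<Rightarrow> bool" where
  "finite_rank T \<longleftrightarrow> (\<exists>B. finite B \<and> range (blinfun_apply T) \<subseteq> span B)"

definition approximation_property :: "'a::real_normed_vector itself \<Rightarrow> bool" where
  "approximation_property _ \<longleftrightarrow>
     (\<forall>K::'a set. \<forall>e>0. compact K \<longrightarrow>
        (\<exists>S :: 'a \<Rightarrow>\<^sub>L 'a. finite_rank S \<and> (\<forall>x\<in>K. norm (blinfun_apply S x - x) \<le> e)))"

definition compact_operator :: "('a::real_normed_vector \<Rightarrow>\<^sub>L 'b::real_normed_vector) \<Rightarrow> bool" where
  "compact_operator T \<longleftrightarrow> compact (closure (blinfun_apply T ` cball 0 1))"

definition unitary :: "'a::real_normed_vector \<Rightarrow> bool" where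
  "unitary z \<longleftrightarrow> norm z = 1 \<and>
     span {f :: 'a \<Rightarrow>\<^sub>L real. norm f \<le> 1 \<and> blinfun_apply f z = 1} = UNIV"

text \<open>The rank-one operator \<open>x\<^sup>* \<otimes> z\<close>.\<close>

lift_definition rank_one ::
  "('a::real_normed_vector \<Rightarrow>\<^sub>L real) \<Rightarrow> 'b::real_normed_vector \<Rightarrow> 'a \<Rightarrow>\<^sub>L 'b"
  is "\<lambda>f z x. blinfun_apply f x *\<^sub>R z"
  by (intro bounded_linear_scaleR_const blinfun.bounded_linear_right)


section \<open>Weak and weak-star topologies, Namioka points\<close>

definition initial_topology :: "('a \<Rightarrow> real) set \<Rightarrow> 'a topology" where
  "initial_topology \<Phi> = topology_generated_by {\<phi> -` U | \<phi> U. \<phi> \<in> \<Phi> \<and> open U}"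

definition weak_topology :: "'a::real_normed_vector topology" where
  "weak_topology = initial_topology (range (blinfun_apply :: ('a \<Rightarrow>\<^sub>L real) \<Rightarrow> 'a \<Rightarrow> real))"

definition weak_star_topology :: "('a::real_normed_vector \<Rightarrow>\<^sub>L real) topology" where
  "weak_star_topology = initial_topology (range (\<lambda>x f. blinfun_apply f x))"

text \<open>A dual space may carry its weak-star topology only through an identification with
  the dual of a predual (as \<open>\<L>(X, Y\<^sup>*)\<close> does), so that topology is a parameter.\<close>

definition namioka_point :: "'a::real_normed_vector topology \<Rightarrow> 'a \<Rightarrow> bool" where
  "namioka_point weak_star z \<longleftrightarrow>
     topcontinuous_at (subtopology weak_star (cball 0 1))
       (subtopology weak_topology (cball 0 1)) (\<lambda>z. z) z"


section \<open>The algebraic tensor product\<close>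

text \<open>A list \<open>[(x\<^sub>1, y\<^sub>1), \<dots>, (x\<^sub>n, y\<^sub>n)]\<close> stands for \<open>\<Sum>\<^sub>i x\<^sub>i \<otimes> y\<^sub>i\<close>. Two such expressions
  are the same tensor iff all bilinear forms take the same value on them.\<close>

definition list_eval :: "('a \<Rightarrow> 'b \<Rightarrow> real) \<Rightarrow> ('a \<times> 'b) list \<Rightarrow> real" where
  "list_eval B ps = (\<Sum>(x, y)\<leftarrow>ps. B x y)"

definition tensor_eq ::
  "('a::real_vector \<times> 'b::real_vector) list \<Rightarrow> ('a \<times> 'b) list \<Rightarrow> bool" where
  "tensor_eq ps qs \<longleftrightarrow> (\<forall>B. bilinear B \<longrightarrow> list_eval B ps = list_eval B qs)"

quotient_type (overloaded) ('a, 'b) tensor = "('a::real_vector \<times> 'b::real_vector) list" / tensor_eq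
  by (rule equivpI) (auto simp: reflp_def symp_def transp_def tensor_eq_def)

lemma list_eval_Nil [simp]: "list_eval B [] = 0"
  by (simp add: list_eval_def)

lemma list_eval_append [simp]: "list_eval B (ps @ qs) = list_eval B ps + list_eval B qs"
  by (simp add: list_eval_def)

lemma list_eval_zero: "(\<And>x y. B x y = 0) \<Longrightarrow> list_eval B ps = 0"
  by (induction ps) (auto simp: list_eval_def)

lemma list_eval_scale:
  assumes "bilinear B"
  shows "list_eval B (map (\<lambda>(x, y). (c *\<^sub>R x, y)) ps) = c * list_eval B ps"
  by (induction ps) (auto simp: list_eval_def bilinear_lmul[OF assms] algebra_simps)

instantiation tensor :: (real_vector, real_vector) real_vector
begin

lift_definition zero_tensor :: "('a, 'b) tensor" is "[]" .

lift_definition plus_tensor :: "('a, 'b) tensor \<Rightarrow> ('a, 'b) tensor \<Rightarrow> ('a, 'b) tensor"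
  is "(@)" by (simp add: tensor_eq_def)

lift_definition scaleR_tensor :: "real \<Rightarrow> ('a, 'b) tensor \<Rightarrow> ('a, 'b) tensor"
  is "\<lambda>c. map (\<lambda>(x, y). (c *\<^sub>R x, y))" by (simp add: tensor_eq_def list_eval_scale)

definition uminus_tensor :: "('a, 'b) tensor \<Rightarrow> ('a, 'b) tensor" where
  "uminus_tensor u = (-1) *\<^sub>R u"

definition minus_tensor :: "('a, 'b) tensor \<Rightarrow> ('a, 'b) tensor \<Rightarrow> ('a, 'b) tensor" where
  "minus_tensor u v = u + (- v)"

instance
proof
  fix u v w :: "('a, 'b) tensor" and a b :: real
  show "u + v + w = u + (v + w)" by transfer (simp add: tensor_eq_def)
  show "u + v = v + u" by transfer (simp add: tensor_eq_def)
  show "0 + u = u" by transfer (simp add: tensor_eq_def)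
  show "- u + u = 0" unfolding uminus_tensor_def
    by transfer (simp add: tensor_eq_def list_eval_scale del: scaleR_minus1_left scaleR_minus_left)
  show "u - v = u + - v" by (rule minus_tensor_def)
  show "a *\<^sub>R (u + v) = a *\<^sub>R u + a *\<^sub>R v"
    by transfer (simp add: tensor_eq_def list_eval_scale algebra_simps)
  show "(a + b) *\<^sub>R u = a *\<^sub>R u + b *\<^sub>R u"
    by transfer (simp add: tensor_eq_def list_eval_scale distrib_right)
  show "a *\<^sub>R b *\<^sub>R u = (a * b) *\<^sub>R u"
    by transfer (simp add: tensor_eq_def list_eval_scale del: map_map)
  show "1 *\<^sub>R u = u"
    by transfer (simp add: tensor_eq_def list_eval_scale)
qed

end

lift_definition elem_tensor :: "'a::real_vector \<Rightarrow> 'b::real_vector \<Rightarrow> ('a, 'b) tensor"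
  is "\<lambda>x y. [(x, y)]" .

lemma bilinear_operator:
  fixes T :: "'a::real_normed_vector \<Rightarrow>\<^sub>L 'b::real_normed_vector \<Rightarrow>\<^sub>L real"
  shows "bilinear (\<lambda>x. blinfun_apply (blinfun_apply T x))"
  by (auto simp: bilinear_def blinfun.bilinear_simps intro!: linearI)

lift_definition tensor_pairing ::
  "('a::real_normed_vector \<Rightarrow>\<^sub>L 'b::real_normed_vector \<Rightarrow>\<^sub>L real) \<Rightarrow> ('a, 'b) tensor \<Rightarrow> real"
  is "\<lambda>T. list_eval (\<lambda>x y. blinfun_apply (blinfun_apply T x) y)"
  by (simp add: tensor_eq_def bilinear_operator)

lemma tensor_pairing_simps [simp]:
  "tensor_pairing T (elem_tensor x y) = blinfun_apply (blinfun_apply T x) y"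
  "tensor_pairing T 0 = 0"
  "tensor_pairing T (u + v) = tensor_pairing T u + tensor_pairing T v"
  "tensor_pairing T (c *\<^sub>R u) = c * tensor_pairing T u"
  by (transfer; simp add: list_eval_def)
    (transfer; simp add: list_eval_scale bilinear_operator)+

lemma tensor_pairing_diff [simp]:
  "tensor_pairing T (u - v) = tensor_pairing T u - tensor_pairing T v"
  using tensor_pairing_simps(3)[of T u "- 1 *\<^sub>R v"]
  unfolding tensor_pairing_simps(4) by simp


section \<open>The projective norm\<close>

definition proj_cost :: "('a::real_normed_vector \<times> 'b::real_normed_vector) list \<Rightarrow> real" where
  "proj_cost ps = (\<Sum>(x, y)\<leftarrow>ps. norm x * norm y)"

definition proj_norm :: "('a::real_normed_vector, 'b::real_normed_vector) tensor \<Rightarrow> real" where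
  "proj_norm u = Inf {proj_cost ps | ps. abs_tensor ps = u}"

lemma proj_cost_nonneg: "0 \<le> proj_cost ps"
  by (induction ps) (auto simp: proj_cost_def)

lemma proj_norm_le: "proj_norm (abs_tensor ps) \<le> proj_cost ps"
  unfolding proj_norm_def
  by (rule cInf_lower) (auto intro!: bdd_belowI[of _ 0] simp: proj_cost_nonneg)

lemma ex_list: "\<exists>ps. abs_tensor ps = u"
  by (metis Quotient_tensor Quotient_abs_rep)

lemma proj_norm_greatest:
  assumes "\<And>ps. abs_tensor ps = u \<Longrightarrow> c \<le> proj_cost ps"
  shows "c \<le> proj_norm u"
  unfolding proj_norm_def using assms ex_list[of u] by (intro cInf_greatest) auto

lemma proj_norm_approx:
  assumes "e > 0"
  obtains ps where "abs_tensor ps = u" "proj_cost ps < proj_norm u + e"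
  using proj_norm_greatest[of u "proj_norm u + e"] assms by force

lemma proj_norm_nonneg [simp]: "0 \<le> proj_norm u"
  by (rule proj_norm_greatest) (rule proj_cost_nonneg)

lemma proj_norm_triangle: "proj_norm (u + v) \<le> proj_norm u + proj_norm v"
proof (rule field_le_epsilon)
  fix e :: real assume "e > 0"
  then obtain ps qs where *: "abs_tensor ps = u" "proj_cost ps < proj_norm u + e/2"
    "abs_tensor qs = v" "proj_cost qs < proj_norm v + e/2"
    by (meson half_gt_zero proj_norm_approx)
  have "u + v = abs_tensor (ps @ qs)"
    using * by (metis plus_tensor.abs_eq)
  then have "proj_norm (u + v) \<le> proj_cost ps + proj_cost qs"
    using proj_norm_le[of "ps @ qs"] by (simp add: proj_cost_def)
  then show "proj_norm (u + v) \<le> proj_norm u + proj_norm v + e"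
    using * by linarith
qed

lemma proj_norm_scaleR_le: "proj_norm (c *\<^sub>R u) \<le> \<bar>c\<bar> * proj_norm u"
proof (cases "c = 0")
  case True
  have "proj_norm (0 :: ('a, 'b) tensor) \<le> 0"
    using proj_norm_le[of "[]"] by (simp add: zero_tensor_def proj_cost_def)
  then show ?thesis using True by simp
next
  case False
  have "proj_norm (c *\<^sub>R u) / \<bar>c\<bar> \<le> proj_norm u"
  proof (rule proj_norm_greatest)
    fix ps assume "abs_tensor ps = u"
    then have "proj_norm (c *\<^sub>R u) \<le> proj_cost (map (\<lambda>(x, y). (c *\<^sub>R x, y)) ps)"
      by (metis proj_norm_le scaleR_tensor.abs_eq)
    also have "\<dots> = \<bar>c\<bar> * proj_cost ps"
      by (induction ps) (auto simp: proj_cost_def algebra_simps)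
    finally show "proj_norm (c *\<^sub>R u) / \<bar>c\<bar> \<le> proj_cost ps"
      using False by (simp add: field_simps)
  qed
  then show ?thesis using False by (simp add: field_simps)
qed

lemma proj_norm_scaleR [simp]: "proj_norm (c *\<^sub>R u) = \<bar>c\<bar> * proj_norm u"
proof (cases "c = 0")
  case True
  then show ?thesis using proj_norm_scaleR_le[of c u] by (simp add: antisym)
next
  case False
  have "proj_norm u \<le> \<bar>inverse c\<bar> * proj_norm (c *\<^sub>R u)"
    using proj_norm_scaleR_le[of "inverse c" "c *\<^sub>R u"] False by simp
  then show ?thesis
    using proj_norm_scaleR_le[of c u] False by (simp add: field_simps)
qed

lemma proj_norm_zero [simp]: "proj_norm 0 = 0"
  using proj_norm_scaleR[of 0 0] by (simp del: proj_norm_scaleR)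

lemma proj_norm_minus_commute: "proj_norm (u - v) = proj_norm (v - u)"
  using proj_norm_scaleR[of "-1" "u - v"] by simp

lemma proj_norm_diff_triangle: "proj_norm (u - w) \<le> proj_norm (u - v) + proj_norm (v - w)"
  using proj_norm_triangle[of "u - v" "v - w"] by simp

lemma proj_norm_abs_diff: "\<bar>proj_norm u - proj_norm v\<bar> \<le> proj_norm (u - v)"
  using proj_norm_triangle[of "u - v" v] proj_norm_triangle[of "v - u" u]
    proj_norm_minus_commute[of u v] by simp

lemma proj_norm_elem_le: "proj_norm (elem_tensor x y) \<le> norm x * norm y"
  using proj_norm_le[of "[(x, y)]"] by (simp add: elem_tensor_def proj_cost_def)

lemma abs_tensor_pairing_le: "\<bar>tensor_pairing T u\<bar> \<le> norm T * proj_norm u"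
proof (cases "norm T = 0")
  case True
  then have "tensor_pairing T u = 0"
    by transfer (simp add: list_eval_zero)
  then show ?thesis by simp
next
  case False
  have "\<bar>tensor_pairing T u\<bar> / norm T \<le> proj_norm u"
  proof (rule proj_norm_greatest)
    fix ps assume "abs_tensor ps = u"
    then have "tensor_pairing T u = list_eval (\<lambda>x y. T x y) ps"
      using tensor_pairing.abs_eq by metis
    also have "\<bar>\<dots>\<bar> \<le> norm T * proj_cost ps"
    proof (induction ps)
      case (Cons p ps)
      obtain x y where p: "p = (x, y)" by (cases p)
      have "\<bar>T x y\<bar> \<le> norm (T x) * norm y"
        using norm_blinfun[of "T x" y] by simp
      also have "\<dots> \<le> norm T * norm x * norm y"
        by (intro mult_right_mono norm_blinfun) auto
      finally have "\<bar>T x y\<bar> \<le> norm T * (norm x * norm y)" by (simp add: mult.assoc)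
      then show ?case using Cons
        by (simp add: p list_eval_def proj_cost_def distrib_left)
    qed (simp add: proj_cost_def)
    finally show "\<bar>tensor_pairing T u\<bar> / norm T \<le> proj_cost ps"
      using False by (simp add: field_simps)
  qed
  then show ?thesis using False by (simp add: field_simps)
qed


lifting_forget tensor.lifting

section \<open>The projective tensor product\<close>

text \<open>The completion of the algebraic tensor product under the projective norm: Cauchy
  sequences modulo null sequences.\<close>

definition tensor_Cauchy ::
  "(nat \<Rightarrow> ('a::real_normed_vector, 'b::real_normed_vector) tensor) \<Rightarrow> bool" where
  "tensor_Cauchy U \<longleftrightarrow> (\<forall>e>0. \<exists>N. \<forall>m\<ge>N. \<forall>n\<ge>N. proj_norm (U m - U n) < e)"

definition tensor_seq_eq ::
  "(nat \<Rightarrow> ('a::real_normed_vector, 'b::real_normed_vector) tensor) \<Rightarrow>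
   (nat \<Rightarrow> ('a, 'b) tensor) \<Rightarrow> bool" where
  "tensor_seq_eq U V \<longleftrightarrow>
     tensor_Cauchy U \<and> tensor_Cauchy V \<and> (\<lambda>n. proj_norm (U n - V n)) \<longlonglongrightarrow> 0"

lemma tensor_Cauchy_const: "tensor_Cauchy (\<lambda>_. u)"
  by (simp add: tensor_Cauchy_def)

lemma tensor_Cauchy_add:
  assumes "tensor_Cauchy U" "tensor_Cauchy V"
  shows "tensor_Cauchy (\<lambda>n. U n + V n)"
  unfolding tensor_Cauchy_def
proof (intro allI impI)
  fix e :: real assume "e > 0"
  then obtain N M where *: "\<forall>m\<ge>N. \<forall>n\<ge>N. proj_norm (U m - U n) < e/2"
    "\<forall>m\<ge>M. \<forall>n\<ge>M. proj_norm (V m - V n) < e/2"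
    using assms unfolding tensor_Cauchy_def by (meson half_gt_zero)
  have "proj_norm (U m + V m - (U n + V n)) < e" if "m \<ge> max N M" "n \<ge> max N M" for m n
  proof -
    have "proj_norm (U m + V m - (U n + V n)) \<le> proj_norm (U m - U n) + proj_norm (V m - V n)"
      using proj_norm_triangle[of "U m - U n" "V m - V n"] by (simp add: algebra_simps)
    moreover have "proj_norm (U m - U n) < e/2" "proj_norm (V m - V n) < e/2"
      using * that by auto
    ultimately show ?thesis by linarith
  qed
  then show "\<exists>N. \<forall>m\<ge>N. \<forall>n\<ge>N. proj_norm (U m + V m - (U n + V n)) < e" by blast
qed

lemma tensor_Cauchy_scaleR:
  assumes "tensor_Cauchy U"
  shows "tensor_Cauchy (\<lambda>n. c *\<^sub>R U n)"
  unfolding tensor_Cauchy_def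
proof (intro allI impI)
  fix e :: real assume "e > 0"
  then have "e / (\<bar>c\<bar> + 1) > 0" by simp
  then obtain N where *: "\<forall>m\<ge>N. \<forall>n\<ge>N. proj_norm (U m - U n) < e / (\<bar>c\<bar> + 1)"
    using assms unfolding tensor_Cauchy_def by meson
  have "proj_norm (c *\<^sub>R U m - c *\<^sub>R U n) < e" if "m \<ge> N" "n \<ge> N" for m n
  proof -
    have "(\<bar>c\<bar> + 1) * proj_norm (U m - U n) < e"
      using * that by (simp add: field_simps)
    moreover have "proj_norm (c *\<^sub>R U m - c *\<^sub>R U n) = \<bar>c\<bar> * proj_norm (U m - U n)"
      by (simp flip: scaleR_diff_right)
    ultimately show ?thesis
      using proj_norm_nonneg[of "U m - U n"] unfolding distrib_right by linarith
  qed
  then show "\<exists>N. \<forall>m\<ge>N. \<forall>n\<ge>N. proj_norm (c *\<^sub>R U m - c *\<^sub>R U n) < e" by blast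
qed

lemma tensor_seq_eq_refl: "tensor_Cauchy U \<Longrightarrow> tensor_seq_eq U U"
  by (simp add: tensor_seq_eq_def)

lemma part_equivp_tensor_seq_eq: "part_equivp tensor_seq_eq"
proof (rule part_equivpI)
  show "\<exists>U. tensor_seq_eq U U"
    using tensor_seq_eq_refl tensor_Cauchy_const by blast
  show "symp tensor_seq_eq"
    by (rule sympI) (simp add: tensor_seq_eq_def proj_norm_minus_commute)
  show "transp tensor_seq_eq"
  proof (rule transpI)
    fix U V W assume *: "tensor_seq_eq U V" "tensor_seq_eq V W"
    have "(\<lambda>n. proj_norm (U n - V n) + proj_norm (V n - W n)) \<longlonglongrightarrow> 0"
      using * tendsto_add[of _ 0 _ _ 0] by (fastforce simp: tensor_seq_eq_def)
    then have "(\<lambda>n. proj_norm (U n - W n)) \<longlonglongrightarrow> 0"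
      by (rule Lim_null_comparison[rotated]) (simp add: proj_norm_diff_triangle)
    then show "tensor_seq_eq U W" using * by (simp add: tensor_seq_eq_def)
  qed
qed

quotient_type (overloaded) ('a, 'b) proj_tensor =
  "nat \<Rightarrow> ('a::real_normed_vector, 'b::real_normed_vector) tensor" / partial: tensor_seq_eq
  by (rule part_equivp_tensor_seq_eq)

lemma Domainp_cr_proj_tensor [transfer_domain_rule]:
  "Domainp cr_proj_tensor = tensor_Cauchy"
  by (auto simp: proj_tensor.domain tensor_seq_eq_def fun_eq_iff)

lemma tensor_Cauchy_Lipschitz:
  fixes f :: "('a::real_normed_vector, 'b::real_normed_vector) tensor \<Rightarrow> real"
  assumes f: "\<And>u v. \<bar>f u - f v\<bar> \<le> C * proj_norm (u - v)" and U: "tensor_Cauchy U"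
  shows "convergent (\<lambda>n. f (U n))"
  unfolding Cauchy_convergent_iff[symmetric]
proof (rule CauchyI)
  fix e :: real assume "e > 0"
  then have "e / (\<bar>C\<bar> + 1) > 0" by simp
  then obtain N where N: "\<forall>m\<ge>N. \<forall>n\<ge>N. proj_norm (U m - U n) < e / (\<bar>C\<bar> + 1)"
    using U unfolding tensor_Cauchy_def by meson
  have "norm (f (U m) - f (U n)) < e" if "m \<ge> N" "n \<ge> N" for m n
  proof -
    have "\<bar>f (U m) - f (U n)\<bar> \<le> C * proj_norm (U m - U n)" by (rule f)
    also have "\<dots> \<le> (\<bar>C\<bar> + 1) * proj_norm (U m - U n)"
      by (intro mult_right_mono) auto
    also have "\<dots> < e" using N that by (simp add: field_simps)
    finally show ?thesis by simp
  qed
  then show "\<exists>N. \<forall>m\<ge>N. \<forall>n\<ge>N. norm (f (U m) - f (U n)) < e" by blast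
qed

lemma tensor_seq_eq_Lipschitz:
  fixes f :: "('a::real_normed_vector, 'b::real_normed_vector) tensor \<Rightarrow> real"
  assumes f: "\<And>u v. \<bar>f u - f v\<bar> \<le> C * proj_norm (u - v)" and UV: "tensor_seq_eq U V"
  shows "lim (\<lambda>n. f (U n)) = lim (\<lambda>n. f (V n))"
proof -
  have UV': "tensor_Cauchy U" "tensor_Cauchy V" "(\<lambda>n. proj_norm (U n - V n)) \<longlonglongrightarrow> 0"
    using UV by (auto simp: tensor_seq_eq_def)
  have "(\<lambda>n. C * proj_norm (U n - V n)) \<longlonglongrightarrow> 0"
    using tendsto_mult_left[OF UV'(3), of C] by simp
  then have "(\<lambda>n. f (U n) - f (V n)) \<longlonglongrightarrow> 0"
    by (rule Lim_null_comparison[rotated]) (simp add: f)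
  moreover have "(\<lambda>n. f (U n) - f (V n)) \<longlonglongrightarrow> lim (\<lambda>n. f (U n)) - lim (\<lambda>n. f (V n))"
    using tensor_Cauchy_Lipschitz[OF f UV'(1)] tensor_Cauchy_Lipschitz[OF f UV'(2)]
    by (intro tendsto_diff) (simp_all add: convergent_LIMSEQ_iff)
  ultimately show ?thesis using LIMSEQ_unique by fastforce
qed

lemma proj_norm_Lipschitz: "\<bar>proj_norm u - proj_norm v\<bar> \<le> 1 * proj_norm (u - v)"
  using proj_norm_abs_diff by simp

lemma tensor_Cauchy_proj_norm:
  "tensor_Cauchy U \<Longrightarrow> (\<lambda>n. proj_norm (U n)) \<longlonglongrightarrow> lim (\<lambda>n. proj_norm (U n))"
  using tensor_Cauchy_Lipschitz[of proj_norm 1 U, OF proj_norm_Lipschitz]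
  by (simp add: convergent_LIMSEQ_iff)

lemma tensor_seq_eq_add:
  assumes "tensor_seq_eq U U'" "tensor_seq_eq V V'"
  shows "tensor_seq_eq (\<lambda>n. U n + V n) (\<lambda>n. U' n + V' n)"
proof -
  have "(\<lambda>n. proj_norm (U n - U' n) + proj_norm (V n - V' n)) \<longlonglongrightarrow> 0"
    using assms tendsto_add[of _ 0 _ _ 0] by (fastforce simp: tensor_seq_eq_def)
  then have "(\<lambda>n. proj_norm (U n + V n - (U' n + V' n))) \<longlonglongrightarrow> 0"
  proof (rule Lim_null_comparison[rotated], intro always_eventually allI)
    fix n
    show "norm (proj_norm (U n + V n - (U' n + V' n)))
        \<le> proj_norm (U n - U' n) + proj_norm (V n - V' n)"
      using proj_norm_triangle[of "U n - U' n" "V n - V' n"] by (simp add: algebra_simps)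
  qed
  then show ?thesis using assms by (simp add: tensor_seq_eq_def tensor_Cauchy_add)
qed

lemma tensor_seq_eq_scaleR:
  assumes "tensor_seq_eq U V"
  shows "tensor_seq_eq (\<lambda>n. c *\<^sub>R U n) (\<lambda>n. c *\<^sub>R V n)"
  using assms tendsto_mult_left[of "\<lambda>n. proj_norm (U n - V n)" 0 sequentially "\<bar>c\<bar>"]
  by (simp add: tensor_seq_eq_def tensor_Cauchy_scaleR flip: scaleR_diff_right)

instantiation proj_tensor :: (real_normed_vector, real_normed_vector) real_normed_vector
begin

lift_definition zero_proj_tensor :: "('a, 'b) proj_tensor" is "\<lambda>_. 0"
  by (simp add: tensor_seq_eq_refl tensor_Cauchy_const)

lift_definition plus_proj_tensor ::
  "('a, 'b) proj_tensor \<Rightarrow> ('a, 'b) proj_tensor \<Rightarrow> ('a, 'b) proj_tensor"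
  is "\<lambda>U V n. U n + V n" by (rule tensor_seq_eq_add)

lift_definition scaleR_proj_tensor :: "real \<Rightarrow> ('a, 'b) proj_tensor \<Rightarrow> ('a, 'b) proj_tensor"
  is "\<lambda>c U n. c *\<^sub>R U n" by (rule tensor_seq_eq_scaleR)

lift_definition norm_proj_tensor :: "('a, 'b) proj_tensor \<Rightarrow> real"
  is "\<lambda>U. lim (\<lambda>n. proj_norm (U n))"
  by (rule tensor_seq_eq_Lipschitz[OF proj_norm_Lipschitz])

definition uminus_proj_tensor :: "('a, 'b) proj_tensor \<Rightarrow> ('a, 'b) proj_tensor" where
  "uminus_proj_tensor p = (-1) *\<^sub>R p"

definition minus_proj_tensor ::
  "('a, 'b) proj_tensor \<Rightarrow> ('a, 'b) proj_tensor \<Rightarrow> ('a, 'b) proj_tensor" where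
  "minus_proj_tensor p q = p + (- q)"

definition sgn_proj_tensor :: "('a, 'b) proj_tensor \<Rightarrow> ('a, 'b) proj_tensor" where
  "sgn_proj_tensor p = inverse (norm p) *\<^sub>R p"

definition dist_proj_tensor :: "('a, 'b) proj_tensor \<Rightarrow> ('a, 'b) proj_tensor \<Rightarrow> real" where
  "dist_proj_tensor p q = norm (p - q)"

definition uniformity_proj_tensor ::
  "(('a, 'b) proj_tensor \<times> ('a, 'b) proj_tensor) filter" where
  "uniformity_proj_tensor = (INF e\<in>{0<..}. principal {(p, q). dist p q < e})"

definition open_proj_tensor :: "('a, 'b) proj_tensor set \<Rightarrow> bool" where
  "open_proj_tensor S = (\<forall>p\<in>S. \<forall>\<^sub>F (p', q) in uniformity. p' = p \<longrightarrow> q \<in> S)"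

instance
proof
  fix p q r :: "('a, 'b) proj_tensor" and a b :: real
  note refl = tensor_seq_eq_refl tensor_Cauchy_const tensor_Cauchy_add tensor_Cauchy_scaleR
  show "p + q + r = p + (q + r)" by transfer (simp add: add.assoc refl)
  show "p + q = q + p" by transfer (simp add: add.commute refl)
  show "0 + p = p" by transfer (simp add: refl)
  show "- p + p = 0" unfolding uminus_proj_tensor_def by transfer (simp add: refl)
  show "p - q = p + - q" by (rule minus_proj_tensor_def)
  show "a *\<^sub>R (p + q) = a *\<^sub>R p + a *\<^sub>R q"
    by transfer (simp add: scaleR_add_right refl)
  show "(a + b) *\<^sub>R p = a *\<^sub>R p + b *\<^sub>R p"
    by transfer (simp add: scaleR_add_left refl)
  show "a *\<^sub>R b *\<^sub>R p = (a * b) *\<^sub>R p" by transfer (simp add: refl)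
  show "1 *\<^sub>R p = p" by transfer (simp add: refl)
  show "sgn p = inverse (norm p) *\<^sub>R p" by (rule sgn_proj_tensor_def)
  show "dist p q = norm (p - q)" by (rule dist_proj_tensor_def)
  show "uniformity = (INF e\<in>{0<..}. principal {(p, q :: ('a, 'b) proj_tensor). dist p q < e})"
    by (rule uniformity_proj_tensor_def)
  show "open S = (\<forall>p\<in>S. \<forall>\<^sub>F (p', q) in uniformity. p' = p \<longrightarrow> q \<in> S)"
    for S :: "('a, 'b) proj_tensor set" by (rule open_proj_tensor_def)
  show "norm p = 0 \<longleftrightarrow> p = 0"
  proof transfer
    fix U :: "nat \<Rightarrow> ('a, 'b) tensor" assume U: "tensor_Cauchy U"
    show "lim (\<lambda>n. proj_norm (U n)) = 0 \<longleftrightarrow> tensor_seq_eq U (\<lambda>_. 0)"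
    proof
      assume "lim (\<lambda>n. proj_norm (U n)) = 0"
      then have "(\<lambda>n. proj_norm (U n)) \<longlonglongrightarrow> 0"
        using tensor_Cauchy_proj_norm[OF U] by simp
      then show "tensor_seq_eq U (\<lambda>_. 0)"
        using U by (simp add: tensor_seq_eq_def tensor_Cauchy_const)
    next
      assume "tensor_seq_eq U (\<lambda>_. 0)"
      then have "(\<lambda>n. proj_norm (U n)) \<longlonglongrightarrow> 0"
        by (simp add: tensor_seq_eq_def)
      then show "lim (\<lambda>n. proj_norm (U n)) = 0" by (rule limI)
    qed
  qed
  show "norm (p + q) \<le> norm p + norm q"
  proof transfer
    fix U V :: "nat \<Rightarrow> ('a, 'b) tensor" assume "tensor_Cauchy U" "tensor_Cauchy V"
    then show "lim (\<lambda>n. proj_norm (U n + V n)) \<le> lim (\<lambda>n. proj_norm (U n)) + lim (\<lambda>n. proj_norm (V n))"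
      by (intro LIMSEQ_le[OF tensor_Cauchy_proj_norm[OF tensor_Cauchy_add]
            tendsto_add[OF tensor_Cauchy_proj_norm tensor_Cauchy_proj_norm]])
        (auto intro: proj_norm_triangle)
  qed
  show "norm (a *\<^sub>R p) = \<bar>a\<bar> * norm p"
  proof transfer
    fix U :: "nat \<Rightarrow> ('a, 'b) tensor" and a :: real assume "tensor_Cauchy U"
    from tendsto_mult_left[OF tensor_Cauchy_proj_norm[OF this], of "\<bar>a\<bar>"]
    show "lim (\<lambda>n. proj_norm (a *\<^sub>R U n)) = \<bar>a\<bar> * lim (\<lambda>n. proj_norm (U n))"
      unfolding proj_norm_scaleR by (rule limI)
  qed
qed

end

lift_definition proj_embedding ::
  "('a::real_normed_vector, 'b::real_normed_vector) tensor \<Rightarrow> ('a, 'b) proj_tensor"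
  is "\<lambda>u _. u" by (simp add: tensor_seq_eq_refl tensor_Cauchy_const)

lemma norm_proj_embedding [simp]: "norm (proj_embedding u) = proj_norm u"
  by transfer simp

lemma proj_embedding_simps [simp]:
  "proj_embedding 0 = 0"
  "proj_embedding (u + v) = proj_embedding u + proj_embedding v"
  "proj_embedding (c *\<^sub>R u) = c *\<^sub>R proj_embedding u"
  by (transfer; simp add: tensor_seq_eq_refl tensor_Cauchy_const)+

lemma proj_embedding_diff [simp]:
  "proj_embedding (u - v) = proj_embedding u - proj_embedding v"
  using proj_embedding_simps(2)[of u "- 1 *\<^sub>R v"]
  unfolding proj_embedding_simps(3) by simp

lemma proj_embedding_tendsto:
  assumes "tensor_Cauchy U"
  shows "(\<lambda>n. proj_embedding (U n)) \<longlonglongrightarrow> abs_proj_tensor U"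
proof (rule LIMSEQ_I)
  fix e :: real assume "e > 0"
  then obtain N where N: "\<forall>m\<ge>N. \<forall>n\<ge>N. proj_norm (U m - U n) < e / 2"
    using assms unfolding tensor_Cauchy_def by (meson half_gt_zero)
  have "norm (proj_embedding (U m) - abs_proj_tensor U) < e" if "m \<ge> N" for m
  proof -
    have *: "proj_embedding (U m) - abs_proj_tensor U
        = abs_proj_tensor (\<lambda>n. U m + (- 1) *\<^sub>R U n)"
      unfolding minus_proj_tensor_def uminus_proj_tensor_def
      using assms
      by (simp add: proj_embedding_def plus_proj_tensor.abs_eq scaleR_proj_tensor.abs_eq
          tensor_seq_eq_refl tensor_Cauchy_const tensor_Cauchy_scaleR
          del: scaleR_minus1_left scaleR_minus_left)
    have C: "tensor_Cauchy (\<lambda>n. U m + (- 1) *\<^sub>R U n)"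
      by (intro tensor_Cauchy_add tensor_Cauchy_const tensor_Cauchy_scaleR assms)
    have "norm (proj_embedding (U m) - abs_proj_tensor U) = lim (\<lambda>n. proj_norm (U m - U n))"
      unfolding * using C by (simp add: norm_proj_tensor.abs_eq tensor_seq_eq_refl)
    also have "\<dots> \<le> e / 2"
      using tensor_Cauchy_proj_norm[OF C] N that
      by (intro LIMSEQ_le_const2) (auto intro!: exI[of _ N] less_imp_le)
    finally show ?thesis using \<open>e > 0\<close> by simp
  qed
  then show "\<exists>N. \<forall>m\<ge>N. norm (proj_embedding (U m) - abs_proj_tensor U) < e" by blast
qed

lemma proj_embedding_approx:
  obtains U where "tensor_Cauchy U" "(\<lambda>n. proj_embedding (U n)) \<longlonglongrightarrow> p"
proof -
  obtain U where "tensor_Cauchy U" "p = abs_proj_tensor U"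
    by (induction p) (auto simp: tensor_seq_eq_def)
  then show thesis using that proj_embedding_tendsto by blast
qed

instance proj_tensor :: (real_normed_vector, real_normed_vector) banach
proof
  fix P :: "nat \<Rightarrow> ('a, 'b) proj_tensor" assume P: "Cauchy P"
  have "\<exists>u. norm (P n - proj_embedding u) < 1 / (real n + 1)" for n
  proof -
    obtain U where U: "(\<lambda>k. proj_embedding (U k)) \<longlonglongrightarrow> P n" using proj_embedding_approx .
    have "1 / (real n + 1) > 0" by simp
    from LIMSEQ_D[OF U this] obtain k where "norm (proj_embedding (U k) - P n) < 1 / (real n + 1)"
      by blast
    then show ?thesis by (subst (asm) norm_minus_commute) blast
  qed
  then obtain U where U: "\<And>n. norm (P n - proj_embedding (U n)) < 1 / (real n + 1)" by metis
  have "(\<lambda>n. 1 / (real n + 1)) \<longlonglongrightarrow> 0"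
    using LIMSEQ_inverse_real_of_nat by (simp add: inverse_eq_divide add.commute)
  then have lim: "(\<lambda>n. P n - proj_embedding (U n)) \<longlonglongrightarrow> 0"
    by (rule Lim_null_comparison[rotated]) (simp add: U less_imp_le)
  have "Cauchy (\<lambda>n. proj_embedding (U n))"
  proof (rule metric_CauchyI)
    fix e :: real assume "e > 0"
    then have "e / 3 > 0" by simp
    obtain N where N: "\<forall>m\<ge>N. \<forall>n\<ge>N. dist (P m) (P n) < e / 3"
      using metric_CauchyD[OF P \<open>e / 3 > 0\<close>] by blast
    obtain M where M: "\<forall>n\<ge>M. dist (P n) (proj_embedding (U n)) < e / 3"
      using LIMSEQ_D[OF lim \<open>e / 3 > 0\<close>] by (auto simp: dist_norm)
    have "dist (proj_embedding (U m)) (proj_embedding (U n)) < e"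
      if "m \<ge> max N M" "n \<ge> max N M" for m n
    proof -
      have "dist (P m) (P n) < e / 3" "dist (P m) (proj_embedding (U m)) < e / 3"
        "dist (P n) (proj_embedding (U n)) < e / 3"
        using N M that by auto
      then show ?thesis
        using dist_triangle3[of "proj_embedding (U m)" "proj_embedding (U n)" "P m"]
          dist_triangle[of "P m" "proj_embedding (U n)" "P n"] by linarith
    qed
    then show "\<exists>N. \<forall>m\<ge>N. \<forall>n\<ge>N. dist (proj_embedding (U m)) (proj_embedding (U n)) < e"
      by blast
  qed
  then have "tensor_Cauchy U"
    by (simp add: tensor_Cauchy_def Cauchy_iff flip: proj_embedding_diff)
  from tendsto_add[OF lim proj_embedding_tendsto[OF this]]
  show "convergent P" by (auto simp: convergent_def)
qed


section \<open>\<open>\<L>(X, Y\<^sup>*)\<close> as the dual of the projective tensor product\<close>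

definition proj_elem ::
  "'a::real_normed_vector \<Rightarrow> 'b::real_normed_vector \<Rightarrow> ('a, 'b) proj_tensor" where
  "proj_elem x y = proj_embedding (elem_tensor x y)"

lemma proj_embedding_sum_elem:
  "proj_embedding (abs_tensor ps) = (\<Sum>(x, y)\<leftarrow>ps. proj_elem x y)"
proof (induction ps)
  case Nil
  then show ?case by (simp flip: zero_tensor_def)
next
  case (Cons p ps)
  have "abs_tensor (p # ps) = elem_tensor (fst p) (snd p) + abs_tensor ps"
    by (simp add: elem_tensor.abs_eq plus_tensor.abs_eq)
  then show ?case using Cons by (simp add: proj_elem_def case_prod_beta)
qed

lemma functional_eqI:
  fixes \<phi> \<psi> :: "('a::real_normed_vector, 'b::real_normed_vector) proj_tensor \<Rightarrow>\<^sub>L real"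
  assumes "\<And>x y. blinfun_apply \<phi> (proj_elem x y) = blinfun_apply \<psi> (proj_elem x y)"
  shows "\<phi> = \<psi>"
proof (rule blinfun_eqI)
  fix p :: "('a, 'b) proj_tensor"
  have sum: "blinfun_apply \<eta> (\<Sum>(x, y)\<leftarrow>ps. proj_elem x y)
      = (\<Sum>(x, y)\<leftarrow>ps. blinfun_apply \<eta> (proj_elem x y))"
    for \<eta> :: "('a, 'b) proj_tensor \<Rightarrow>\<^sub>L real" and ps
    by (induction ps) (auto simp: blinfun.bilinear_simps)
  have eq: "blinfun_apply \<phi> (proj_embedding u) = blinfun_apply \<psi> (proj_embedding u)" for u
    using ex_list[of u] assms by (auto simp: proj_embedding_sum_elem sum)
  obtain U where U: "(\<lambda>n. proj_embedding (U n)) \<longlonglongrightarrow> p" using proj_embedding_approx .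
  show "blinfun_apply \<phi> p = blinfun_apply \<psi> p"
    using blinfun.tendsto[OF tendsto_const U, of \<phi>] blinfun.tendsto[OF tendsto_const U, of \<psi>]
    unfolding eq by (rule LIMSEQ_unique)
qed

lemma norm_proj_elem_le: "norm (proj_elem x y) \<le> norm x * norm y"
  by (simp add: proj_elem_def proj_norm_elem_le)

lemma tensor_pairing_Lipschitz:
  "\<bar>tensor_pairing T u - tensor_pairing T v\<bar> \<le> norm T * proj_norm (u - v)"
  using abs_tensor_pairing_le[of T "u - v"] by simp

lift_definition proj_pairing ::
  "('a::real_normed_vector \<Rightarrow>\<^sub>L 'b::real_normed_vector \<Rightarrow>\<^sub>L real) \<Rightarrow> ('a, 'b) proj_tensor \<Rightarrow> real"
  is "\<lambda>T U. lim (\<lambda>n. tensor_pairing T (U n))"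
  by (rule tensor_seq_eq_Lipschitz[OF tensor_pairing_Lipschitz])

lemma tensor_Cauchy_pairing:
  "tensor_Cauchy U \<Longrightarrow>
     (\<lambda>n. tensor_pairing T (U n)) \<longlonglongrightarrow> lim (\<lambda>n. tensor_pairing T (U n))"
  using tensor_Cauchy_Lipschitz[of "tensor_pairing T", OF tensor_pairing_Lipschitz]
  by (simp add: convergent_LIMSEQ_iff)

lemma abs_proj_pairing_le:
  fixes T :: "'a::real_normed_vector \<Rightarrow>\<^sub>L 'b::real_normed_vector \<Rightarrow>\<^sub>L real"
  shows "\<bar>proj_pairing T p\<bar> \<le> norm T * norm p"
proof (induction p)
  case (1 U)
  then have U: "tensor_Cauchy U" by (simp add: tensor_seq_eq_def)
  have "\<bar>lim (\<lambda>n. tensor_pairing T (U n))\<bar> \<le> norm T * lim (\<lambda>n. proj_norm (U n))"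
    by (rule LIMSEQ_le[OF tendsto_rabs[OF tensor_Cauchy_pairing[OF U]]
          tendsto_mult_left[OF tensor_Cauchy_proj_norm[OF U]]])
      (auto intro: abs_tensor_pairing_le)
  then show ?case using U
    by (simp add: proj_pairing.abs_eq norm_proj_tensor.abs_eq tensor_seq_eq_refl)
qed

lemma bounded_linear_proj_pairing:
  fixes T :: "'a::real_normed_vector \<Rightarrow>\<^sub>L 'b::real_normed_vector \<Rightarrow>\<^sub>L real"
  shows "bounded_linear (proj_pairing T)"
proof (rule bounded_linear_intro)
  show "proj_pairing T (p + q) = proj_pairing T p + proj_pairing T q" for p q
  proof transfer
    fix T :: "'a \<Rightarrow>\<^sub>L 'b \<Rightarrow>\<^sub>L real" and U V :: "nat \<Rightarrow> ('a, 'b) tensor"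
    assume "tensor_Cauchy U" "tensor_Cauchy V"
    then show "lim (\<lambda>n. tensor_pairing T (U n + V n))
        = lim (\<lambda>n. tensor_pairing T (U n)) + lim (\<lambda>n. tensor_pairing T (V n))"
      by (intro limI) (auto intro!: tendsto_add tensor_Cauchy_pairing)
  qed
  show "proj_pairing T (c *\<^sub>R p) = c *\<^sub>R proj_pairing T p" for c p
  proof transfer
    fix T :: "'a \<Rightarrow>\<^sub>L 'b \<Rightarrow>\<^sub>L real" and U :: "nat \<Rightarrow> ('a, 'b) tensor" and c :: real
    assume "tensor_Cauchy U"
    then show "lim (\<lambda>n. tensor_pairing T (c *\<^sub>R U n)) = c *\<^sub>R lim (\<lambda>n. tensor_pairing T (U n))"
      by (intro limI) (auto intro!: tendsto_mult_left tensor_Cauchy_pairing)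
  qed
  show "norm (proj_pairing T p) \<le> norm p * norm T" for p
    using abs_proj_pairing_le[of T p] by (simp add: mult.commute)
qed

lemma proj_pairing_elem: "proj_pairing T (proj_elem x y) = blinfun_apply (blinfun_apply T x) y"
  unfolding proj_elem_def by transfer simp

text \<open>The functional determined by \<open>x \<otimes> y \<mapsto> (T x) y\<close>. It exists and is unique, and
  \<open>T \<mapsto> operator_functional T\<close> is a linear isometric bijection onto the dual of the
  projective tensor product (\<open>linear_operator_functional\<close>, \<open>norm_operator_functional\<close>,
  \<open>bij_operator_functional\<close> below).\<close>

definition operator_functional ::
  "('a::real_normed_vector \<Rightarrow>\<^sub>L 'b::real_normed_vector \<Rightarrow>\<^sub>L real)
    \<Rightarrow> (('a, 'b) proj_tensor \<Rightarrow>\<^sub>L real)" where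
  "operator_functional T = (THE \<phi>. \<forall>x y.
     blinfun_apply \<phi> (proj_elem x y) = blinfun_apply (blinfun_apply T x) y)"

lemma operator_functional_eq: "operator_functional T = Blinfun (proj_pairing T)"
  unfolding operator_functional_def
  by (rule the_equality)
    (auto intro!: functional_eqI
      simp: bounded_linear_Blinfun_apply[OF bounded_linear_proj_pairing] proj_pairing_elem)

lemma operator_functional_elem [simp]:
  "blinfun_apply (operator_functional T) (proj_elem x y) = blinfun_apply (blinfun_apply T x) y"
  by (simp add: operator_functional_eq proj_pairing_elem
      bounded_linear_Blinfun_apply[OF bounded_linear_proj_pairing])

lemma linear_operator_functional: "linear operator_functional"
  by (intro linearI functional_eqI) (simp_all add: blinfun.bilinear_simps)

lemma norm_operator_functional: "norm (operator_functional T) = norm T"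
proof (rule antisym)
  show "norm (operator_functional T) \<le> norm T"
    by (rule norm_blinfun_bound)
      (auto simp: operator_functional_eq abs_proj_pairing_le
        bounded_linear_Blinfun_apply[OF bounded_linear_proj_pairing])
  have "\<bar>blinfun_apply (blinfun_apply T x) y\<bar> \<le> norm (operator_functional T) * norm x * norm y" for x y
  proof -
    have "\<bar>blinfun_apply (blinfun_apply T x) y\<bar> \<le> norm (operator_functional T) * norm (proj_elem x y)"
      using norm_blinfun[of "operator_functional T" "proj_elem x y"] by simp
    also have "\<dots> \<le> norm (operator_functional T) * (norm x * norm y)"
      by (intro mult_left_mono norm_proj_elem_le) auto
    finally show ?thesis by (simp add: mult.assoc)
  qed
  then show "norm T \<le> norm (operator_functional T)"
    by (intro norm_blinfun_bound) auto
qed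

lemma proj_elem_bounded_bilinear: "bounded_bilinear proj_elem"
proof (rule bounded_bilinear.intro)
  have B: "list_eval B [(x, y)] = B x y" for B :: "'a \<Rightarrow> 'b \<Rightarrow> real" and x y
    by (simp add: list_eval_def)
  fix x x' :: 'a and y y' :: 'b and c :: real
  have "elem_tensor (x + x') y = elem_tensor x y + elem_tensor x' y"
    by (simp add: elem_tensor.abs_eq plus_tensor.abs_eq tensor.abs_eq_iff tensor_eq_def
        list_eval_def bilinear_ladd)
  then show "proj_elem (x + x') y = proj_elem x y + proj_elem x' y"
    by (simp add: proj_elem_def)
  have "elem_tensor x (y + y') = elem_tensor x y + elem_tensor x y'"
    by (simp add: elem_tensor.abs_eq plus_tensor.abs_eq tensor.abs_eq_iff tensor_eq_def
        list_eval_def bilinear_radd)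
  then show "proj_elem x (y + y') = proj_elem x y + proj_elem x y'"
    by (simp add: proj_elem_def)
  have "elem_tensor (c *\<^sub>R x) y = c *\<^sub>R elem_tensor x y"
    by (simp add: elem_tensor.abs_eq scaleR_tensor.abs_eq)
  then show "proj_elem (c *\<^sub>R x) y = c *\<^sub>R proj_elem x y"
    by (simp add: proj_elem_def)
  have "elem_tensor x (c *\<^sub>R y) = c *\<^sub>R elem_tensor x y"
    by (simp add: elem_tensor.abs_eq scaleR_tensor.abs_eq tensor.abs_eq_iff tensor_eq_def
        list_eval_def bilinear_lmul bilinear_rmul)
  then show "proj_elem x (c *\<^sub>R y) = c *\<^sub>R proj_elem x y"
    by (simp add: proj_elem_def)
next
  show "\<exists>K. \<forall>(x::'a) (y::'b). norm (proj_elem x y) \<le> norm x * norm y * K"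
    by (intro exI[of _ 1]) (simp add: norm_proj_elem_le)
qed

lemma bij_operator_functional:
  "bij (operator_functional :: ('a::real_normed_vector \<Rightarrow>\<^sub>L 'b::real_normed_vector \<Rightarrow>\<^sub>L real) \<Rightarrow> _)"
proof (rule bijI)
  show "inj (operator_functional :: ('a \<Rightarrow>\<^sub>L 'b \<Rightarrow>\<^sub>L real) \<Rightarrow> _)"
    by (intro injI blinfun_eqI) (metis operator_functional_elem)
  show "surj (operator_functional :: ('a \<Rightarrow>\<^sub>L 'b \<Rightarrow>\<^sub>L real) \<Rightarrow> _)"
  proof (rule surjI)
    fix \<phi> :: "('a, 'b) proj_tensor \<Rightarrow>\<^sub>L real"
    interpret B: bounded_bilinear "\<lambda>y x. blinfun_apply \<phi> (proj_elem x y)"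
    proof (rule bounded_bilinear.flip, rule bounded_bilinear.intro)
      show "\<exists>K. \<forall>(x::'a) (y::'b). norm (blinfun_apply \<phi> (proj_elem x y)) \<le> norm x * norm y * K"
      proof (intro exI allI)
        fix x :: 'a and y :: 'b
        have "norm (blinfun_apply \<phi> (proj_elem x y)) \<le> norm \<phi> * (norm x * norm y)"
          by (rule order_trans[OF norm_blinfun mult_left_mono[OF norm_proj_elem_le]]) simp
        then show "norm (blinfun_apply \<phi> (proj_elem x y)) \<le> norm x * norm y * norm \<phi>"
          by (simp only: mult.commute)
      qed
    qed (simp_all add: bounded_bilinear.add_left[OF proj_elem_bounded_bilinear]
        bounded_bilinear.add_right[OF proj_elem_bounded_bilinear]
        bounded_bilinear.scaleR_left[OF proj_elem_bounded_bilinear]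
        bounded_bilinear.scaleR_right[OF proj_elem_bounded_bilinear] blinfun.bilinear_simps)
    show "operator_functional (Blinfun B.prod_left) = \<phi>"
      by (intro functional_eqI)
        (simp add: bounded_linear_Blinfun_apply[OF B.bounded_linear_prod_left])
  qed
qed

definition operator_weak_star_topology ::
  "('a::real_normed_vector \<Rightarrow>\<^sub>L 'b::real_normed_vector \<Rightarrow>\<^sub>L real) topology" where
  "operator_weak_star_topology = pullback_topology UNIV operator_functional weak_star_topology"

end

theory Submission
  imports Defs
begin

text \<open>
  Put \<open>Z = Y\<^sup>*\<close> and \<open>T\<^sub>0 = x\<^sub>0\<^sup>* \<otimes> y\<^sub>0\<^sup>*\<close>. Every \<open>\<Psi> \<in> X\<^sup>*\<^sup>*\<close> and \<open>f \<in> Z\<^sup>*\<close> give a functional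
  \<open>\<Psi> \<otimes> f : T \<mapsto> \<Psi>(f \<circ> T)\<close> on \<open>\<L>(X, Z)\<close>. The proof separates two questions: why the functionals
  \<open>\<Psi> \<otimes> f\<close> are weak-star continuous at \<open>T\<^sub>0\<close> on the unit ball, and why they control all other
  functionals.

  The first is where the unitary and the Namioka point enter (\<open>rank_one_unitary_nhds\<close>). If
  \<open>\<parallel>f\<parallel> \<le> 1\<close> and \<open>f(y\<^sub>0\<^sup>*) = 1\<close>, then \<open>T \<mapsto> f \<circ> T\<close> maps the ball of \<open>\<L>(X, Z)\<close> into that of \<open>X\<^sup>*\<close> and
  \<open>T\<^sub>0\<close> to \<open>x\<^sub>0\<^sup>*\<close>; since \<open>f\<close> is evaluation at a point of \<open>Y\<close> by reflexivity, the map is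
  weak-star continuous, and the Namioka property of \<open>x\<^sub>0\<^sup>*\<close> finishes. Such \<open>f\<close> span \<open>Z\<^sup>*\<close>.

  The second is answered by \<open>zero_adherent_imp_norm_adherent\<close>: if \<open>Z\<close> is reflexive and all
  operators \<open>X \<rightarrow> Z\<close> are compact, then a bounded convex set of operators whose closure
  in the topology of the functionals \<open>\<Psi> \<otimes> f\<close> contains \<open>0\<close> contains operators of arbitrarily small norm.
  The set \<open>{T - T\<^sub>0 | \<parallel>T\<parallel> \<le> 1, \<phi>(T) \<ge> \<phi>(T\<^sub>0) + \<epsilon>}\<close> stays away from \<open>0\<close> in norm for every functional
  \<open>\<phi>\<close>, hence also in that topology. By the first point, \<open>\<phi>(T) < \<phi>(T\<^sub>0) + \<epsilon>\<close> then holds on the ball in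
  some weak-star neighbourhood of \<open>T\<^sub>0\<close>; together with the same for \<open>-\<phi>\<close> this is the claim.

  For the second point, two observations are combined. First, a compact operator \<open>U\<close> attains its
  norm at some \<open>\<Psi> \<otimes> f\<close> with \<open>\<parallel>\<Psi>\<parallel>, \<parallel>f\<parallel> \<le> 1\<close>, because \<open>\<parallel>\<cdot>\<parallel>\<close> attains its maximum on the compact closure
  of the image of the ball and there Hahn-Banach provides \<open>f\<close> and then \<open>\<Psi>\<close>. By Simons' inequality
  (\<open>small_convex_combination\<close>), a bounded \<^emph>\<open>sequence\<close> \<open>S\<^sub>n\<close> of operators with
  \<open>\<Psi>(f \<circ> S\<^sub>n) \<rightarrow> 0\<close> for all \<open>\<Psi>, f\<close> therefore has convex combinations of small norm. Second, such a
  sequence can be chosen in the given convex set although adherence only speaks of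
  neighbourhoods: by Mazur's theorem one may make \<open>\<parallel>f \<circ> T\<parallel>\<close> small for finitely many \<open>f\<close> at a time,
  and the finitely many \<open>f\<close> considered at stage \<open>n\<close> are taken from countable sets that norm
  the sums of the ranges of the previous operators, which are separable by compactness.
  A duality argument in the reflexive space \<open>Z\<close> then extends \<open>\<parallel>f \<circ> S\<^sub>n\<parallel> \<rightarrow> 0\<close> to every \<open>f \<in> Z\<^sup>*\<close>.
\<close>

section \<open>Separation by functionals\<close>

text \<open>Homogeneity is asked for positive scalars only; the scalar \<open>0\<close> is then automatic.\<close>

definition sublinear :: "('a::real_vector \<Rightarrow> real) \<Rightarrow> bool" where
  "sublinear p \<longleftrightarrow> (\<forall>x y. p (x + y) \<le> p x + p y) \<and> (\<forall>c>0. \<forall>x. p (c *\<^sub>R x) = c * p x)"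

lemma sublinearD:
  assumes "sublinear p"
  shows "p (x + y) \<le> p x + p y" "c > 0 \<Longrightarrow> p (c *\<^sub>R x) = c * p x" "p 0 = 0" "- p (- x) \<le> p x"
proof -
  show add: "p (x + y) \<le> p x + p y" for x y using assms by (simp add: sublinear_def)
  show scale: "c > 0 \<Longrightarrow> p (c *\<^sub>R x) = c * p x" for c x using assms by (simp add: sublinear_def)
  show zero: "p 0 = 0" using scale[of 2 0] by simp
  show "- p (- x) \<le> p x" using add[of x "- x"] zero by simp
qed

lemma sublinear_norm: "sublinear norm"
  by (simp add: sublinear_def norm_triangle_ineq)

text \<open>
  The Mazur-Orlicz construction. The largest candidate for a sublinear \<open>q \<le> p\<close> with \<open>q(-c) \<le> -\<delta>\<close>
  on \<open>C\<close> is \<open>q(w) = inf {p(w + t c) - t \<delta> | t \<ge> 0, c \<in> C}\<close>: it must lie below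
  \<open>q(w + t c) + t q(-c)\<close>. Convexity of \<open>C\<close> makes it subadditive, and \<open>\<delta> \<le> p\<close> on \<open>C\<close> keeps it finite.
  It is used for a singleton \<open>C\<close> to show that minimal sublinear functionals are linear, and for
  general \<open>C\<close> to separate convex sets.\<close>

lemma sublinear_lowering:
  fixes p :: "'a::real_vector \<Rightarrow> real"
  assumes p: "sublinear p" and "convex C" "C \<noteq> {}" and ge: "\<And>c. c \<in> C \<Longrightarrow> \<delta> \<le> p c"
  obtains q where "sublinear q" "\<And>w. q w \<le> p w" "\<And>c. c \<in> C \<Longrightarrow> q (- c) \<le> - \<delta>"
proof
  define q where "q w = Inf {p (w + t *\<^sub>R c) - t * \<delta> | t c. t \<ge> 0 \<and> c \<in> C}" for w
  have low: "- p (- w) \<le> p (w + t *\<^sub>R c) - t * \<delta>" if "t \<ge> 0" "c \<in> C" for w t c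
  proof -
    have "t * \<delta> \<le> p (t *\<^sub>R c)"
      using that ge[of c] sublinearD(2)[OF p, of t c] sublinearD(3)[OF p]
      by (cases "t = 0") (auto intro: mult_left_mono)
    then show ?thesis using sublinearD(1)[OF p, of "w + t *\<^sub>R c" "- w"] by simp
  qed
  have bdd: "bdd_below {p (w + t *\<^sub>R c) - t * \<delta> | t c. t \<ge> 0 \<and> c \<in> C}" for w
    by (rule bdd_belowI[of _ "- p (- w)"]) (auto simp: low)
  have le: "q w \<le> p (w + t *\<^sub>R c) - t * \<delta>" if "t \<ge> 0" "c \<in> C" for w t c
    unfolding q_def by (rule cInf_lower[OF _ bdd]) (use that in auto)
  have approx: "\<exists>t c. t \<ge> 0 \<and> c \<in> C \<and> p (w + t *\<^sub>R c) - t * \<delta> < q w + e" if "e > 0" for w e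
  proof -
    have "{p (w + t *\<^sub>R c) - t * \<delta> | t c. t \<ge> 0 \<and> c \<in> C} \<noteq> {}"
      using \<open>C \<noteq> {}\<close> order_refl[of "0::real"] by blast
    from cInf_lessD[OF this, of "q w + e"] that show ?thesis by (auto simp: q_def)
  qed
  obtain c0 where c0: "c0 \<in> C" using \<open>C \<noteq> {}\<close> by blast
  show "q w \<le> p w" for w using le[OF order_refl c0, of w] by simp
  show "q (- c) \<le> - \<delta>" if "c \<in> C" for c
    using le[of 1 c "- c"] that sublinearD(3)[OF p] by simp
  have add: "q (v + w) \<le> q v + q w" for v w
  proof (rule field_le_epsilon)
    fix e :: real assume "e > 0"
    then have "e / 2 > 0" by simp
    obtain s a where a: "s \<ge> 0" "a \<in> C" "p (v + s *\<^sub>R a) - s * \<delta> < q v + e / 2"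
      using approx[OF \<open>e / 2 > 0\<close>] by blast
    obtain t b where b: "t \<ge> 0" "b \<in> C" "p (w + t *\<^sub>R b) - t * \<delta> < q w + e / 2"
      using approx[OF \<open>e / 2 > 0\<close>] by blast
    have "\<exists>c\<in>C. s *\<^sub>R a + t *\<^sub>R b = (s + t) *\<^sub>R c"
    proof (cases "s + t = 0")
      case True
      then have "s = 0" "t = 0" using a(1) b(1) by auto
      then show ?thesis using a(2) by auto
    next
      case False
      then have "(s / (s + t)) *\<^sub>R a + (t / (s + t)) *\<^sub>R b \<in> C"
        using a b by (intro convexD[OF \<open>convex C\<close>]) (auto simp flip: add_divide_distrib)
      then show ?thesis
        by (rule bexI[rotated]) (use False in \<open>simp add: scaleR_add_right\<close>)
    qed
    then obtain c where c: "c \<in> C" "s *\<^sub>R a + t *\<^sub>R b = (s + t) *\<^sub>R c" by blast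
    have "q (v + w) \<le> p ((v + w) + (s + t) *\<^sub>R c) - (s + t) * \<delta>"
      using a b c by (intro le) auto
    also have "(v + w) + (s + t) *\<^sub>R c = (v + s *\<^sub>R a) + (w + t *\<^sub>R b)"
      by (simp flip: c(2))
    also have "p \<dots> \<le> p (v + s *\<^sub>R a) + p (w + t *\<^sub>R b)" by (rule sublinearD(1)[OF p])
    finally show "q (v + w) \<le> q v + q w + e" using a(3) b(3) by (simp add: algebra_simps)
  qed
  have scale_le: "q (r *\<^sub>R w) \<le> r * q w" if "r > 0" for r w
  proof (rule field_le_epsilon)
    fix e :: real assume "e > 0"
    then have "e / r > 0" using \<open>r > 0\<close> by simp
    then obtain t c where c: "t \<ge> 0" "c \<in> C" "p (w + t *\<^sub>R c) - t * \<delta> < q w + e / r"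
      using approx by blast
    have "q (r *\<^sub>R w) \<le> p (r *\<^sub>R w + (r * t) *\<^sub>R c) - (r * t) * \<delta>"
      using c \<open>r > 0\<close> by (intro le) auto
    also have "r *\<^sub>R w + (r * t) *\<^sub>R c = r *\<^sub>R (w + t *\<^sub>R c)" by (simp add: scaleR_add_right)
    also have "p \<dots> = r * p (w + t *\<^sub>R c)" by (rule sublinearD(2)[OF p \<open>r > 0\<close>])
    also have "\<dots> - r * t * \<delta> = r * (p (w + t *\<^sub>R c) - t * \<delta>)" by (simp add: algebra_simps)
    also have "\<dots> \<le> r * (q w + e / r)" using c \<open>r > 0\<close> by (intro mult_left_mono) auto
    finally show "q (r *\<^sub>R w) \<le> r * q w + e" using \<open>r > 0\<close> by (simp add: algebra_simps)
  qed
  have "q (r *\<^sub>R w) = r * q w" if "r > 0" for r w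
    using scale_le[OF that, of w] scale_le[of "inverse r" "r *\<^sub>R w"] that
    by (simp add: field_simps)
  then show "sublinear q" using add by (simp add: sublinear_def)
qed

text \<open>
  Hahn-Banach. Pointwise infima of chains of sublinear functionals below \<open>p\<close> are sublinear, being
  bounded below by \<open>-p(-x)\<close>, so Zorn's lemma gives a minimal one, \<open>m\<close>. Lowering \<open>m\<close> at a
  single vector \<open>v\<close> changes nothing, which forces \<open>m(-v) = -m(v)\<close>; an odd sublinear functional is linear.\<close>

lemma exists_linear_le_sublinear:
  fixes p :: "'a::real_vector \<Rightarrow> real"
  assumes p: "sublinear p"
  obtains f where "linear f" "\<And>x. f x \<le> p x"
proof -
  let ?A = "{q. sublinear q \<and> (\<forall>x. q x \<le> p x)}"
  let ?R = "\<lambda>q r :: 'a \<Rightarrow> real. r \<le> q"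
  have "\<exists>m\<in>?A. \<forall>q\<in>?A. ?R m q \<longrightarrow> q = m"
  proof (rule predicate_Zorn)
    show "partial_order_on ?A (relation_of ?R ?A)"
      by (rule partial_order_on_relation_ofI) auto
    fix C assume C: "C \<in> Chains (relation_of ?R ?A)"
    show "\<exists>u\<in>?A. \<forall>q\<in>C. ?R q u"
    proof (cases "C = {}")
      case True
      then show ?thesis using p by auto
    next
      case False
      have sub: "sublinear q" "q x \<le> p x" if "q \<in> C" for q x
        using C that by (auto simp: Chains_def relation_of_def)
      have chain: "q \<le> r \<or> r \<le> q" if "q \<in> C" "r \<in> C" for q r
        using C that by (auto simp: Chains_def relation_of_def)
      define u where "u x = (INF q\<in>C. q x)" for x
      have bdd: "bdd_below ((\<lambda>q. q x) ` C)" for x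
      proof (rule bdd_belowI2)
        fix q assume "q \<in> C"
        then show "- p (- x) \<le> q x"
          using sublinearD(4)[OF sub(1), of q x] sub(2)[of q "- x"] by linarith
      qed
      have le: "u x \<le> q x" if "q \<in> C" for q x
        unfolding u_def by (rule cINF_lower[OF bdd that])
      have approx: "\<exists>q\<in>C. q x < u x + e" if "e > 0" for x e
        using cINF_less_iff[OF False bdd, of x "u x + e"] that by (auto simp: u_def)
      have add: "u (x + y) \<le> u x + u y" for x y
      proof (rule field_le_epsilon)
        fix e :: real assume "e > 0"
        then have "e / 2 > 0" by simp
        obtain q where q: "q \<in> C" "q x < u x + e / 2" using approx[OF \<open>e / 2 > 0\<close>] by blast
        obtain r where r: "r \<in> C" "r y < u y + e / 2" using approx[OF \<open>e / 2 > 0\<close>] by blast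
        obtain s where s: "s \<in> C" "s x \<le> q x" "s y \<le> r y"
          using chain[OF q(1) r(1)] q(1) r(1) by (auto simp: le_fun_def)
        have "u (x + y) \<le> s x + s y"
          using le[OF s(1), of "x + y"] sublinearD(1)[OF sub(1)[OF s(1)], of x y] by linarith
        then show "u (x + y) \<le> u x + u y + e" using s q(2) r(2) by linarith
      qed
      have scale_le: "u (c *\<^sub>R x) \<le> c * u x" if "c > 0" for c x
      proof (rule field_le_epsilon)
        fix e :: real assume "e > 0"
        then have "e / c > 0" using \<open>c > 0\<close> by simp
        then obtain q where q: "q \<in> C" "q x < u x + e / c" using approx by blast
        have "u (c *\<^sub>R x) \<le> c * q x"
          using le[OF q(1), of "c *\<^sub>R x"] sublinearD(2)[OF sub(1)[OF q(1)] \<open>c > 0\<close>] by simp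
        also have "\<dots> \<le> c * (u x + e / c)" using q \<open>c > 0\<close> by (intro mult_left_mono) auto
        finally show "u (c *\<^sub>R x) \<le> c * u x + e" using \<open>c > 0\<close> by (simp add: algebra_simps)
      qed
      have "u (c *\<^sub>R x) = c * u x" if "c > 0" for c x
        using scale_le[OF that, of x] scale_le[of "inverse c" "c *\<^sub>R x"] that
        by (simp add: field_simps)
      then have "sublinear u" using add by (simp add: sublinear_def)
      moreover have "u x \<le> p x" for x
        using False le sub(2) order_trans by blast
      ultimately show ?thesis using le by (intro bexI[of _ u]) (auto simp: le_fun_def)
    qed
  qed
  then obtain m where m: "sublinear m" "\<And>x. m x \<le> p x"
    and min: "\<And>q. sublinear q \<Longrightarrow> (\<And>x. q x \<le> m x) \<Longrightarrow> q = m"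
    by (auto simp: le_fun_def) (metis order_trans)
  have neg: "m (- v) = - m v" for v
  proof -
    obtain q where q: "sublinear q" "\<And>w. q w \<le> m w" "\<And>c. c \<in> {v} \<Longrightarrow> q (- c) \<le> - m v"
      by (rule sublinear_lowering[OF m(1), of "{v}" "m v"]) auto
    then show ?thesis using min[OF q(1,2)] sublinearD(4)[OF m(1), of v] by force
  qed
  have "m (x + y) = m x + m y" for x y
    using sublinearD(1)[OF m(1), of x y] sublinearD(1)[OF m(1), of "x + y" "- y"] neg[of y] by simp
  moreover have "m (c *\<^sub>R x) = c * m x" for c x
  proof -
    consider "c > 0" | "c = 0" | "- c > 0" by linarith
    then show ?thesis
    proof cases
      case 3
      then have "m ((- c) *\<^sub>R x) = (- c) * m x" by (rule sublinearD(2)[OF m(1)])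
      then show ?thesis using neg[of "c *\<^sub>R x"] by simp
    qed (use sublinearD[OF m(1)] in auto)
  qed
  ultimately have "linear m" by (intro linearI) auto
  then show thesis using that m(2) by blast
qed

text \<open>
  The geometric Hahn-Banach theorem in the form needed below: the norm is first lowered to a
  sublinear functional that is at most \<open>-\<delta>\<close> on \<open>-C\<close>, and any linear functional below that one separates.\<close>

theorem separate_convex_from_ball:
  fixes C :: "'a::real_normed_vector set"
  assumes "convex C" "C \<noteq> {}" and ge: "\<And>c. c \<in> C \<Longrightarrow> \<delta> \<le> norm c"
  obtains f :: "'a \<Rightarrow>\<^sub>L real" where "norm f \<le> 1" "\<And>c. c \<in> C \<Longrightarrow> \<delta> \<le> blinfun_apply f c"
proof -
  obtain q where q: "sublinear q" "\<And>w. q w \<le> norm w" "\<And>c. c \<in> C \<Longrightarrow> q (- c) \<le> - \<delta>"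
    using sublinear_lowering[OF sublinear_norm assms] by blast
  obtain f where f: "linear f" "\<And>x. f x \<le> q x"
    using exists_linear_le_sublinear[OF q(1)] by blast
  have le: "f x \<le> norm x" for x using f(2)[of x] q(2)[of x] by linarith
  then have abs: "\<bar>f x\<bar> \<le> norm x" for x
    using le[of "- x"] linear_neg[OF f(1), of x] by (simp add: abs_le_iff le)
  have lin: "bounded_linear f"
    by (rule bounded_linear_intro[where K = 1])
      (auto simp: linear_add[OF f(1)] linear_scale[OF f(1)] abs)
  show thesis
  proof
    show "norm (Blinfun f) \<le> 1"
      by (rule norm_blinfun_bound) (auto simp: bounded_linear_Blinfun_apply[OF lin] abs)
    show "\<delta> \<le> blinfun_apply (Blinfun f) c" if "c \<in> C" for c
      using f(2)[of "- c"] q(3)[OF that] linear_neg[OF f(1), of c]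
      by (simp add: bounded_linear_Blinfun_apply[OF lin])
  qed
qed

lemma norming_functional:
  fixes v :: "'a::real_normed_vector"
  obtains f :: "'a \<Rightarrow>\<^sub>L real" where "norm f \<le> 1" "blinfun_apply f v = norm v"
proof -
  obtain f :: "'a \<Rightarrow>\<^sub>L real" where f: "norm f \<le> 1" "norm v \<le> blinfun_apply f v"
    using separate_convex_from_ball[of "{v}" "norm v"] by auto
  have "norm (blinfun_apply f v) \<le> 1 * norm v"
    by (rule order_trans[OF norm_blinfun mult_right_mono]) (use f in auto)
  then show thesis using that f by simp
qed

lemma separate_point_from_subspace:
  fixes M :: "'a::real_normed_vector set"
  assumes "subspace M" "v \<notin> closure M"
  obtains f :: "'a \<Rightarrow>\<^sub>L real" where "\<And>m. m \<in> M \<Longrightarrow> blinfun_apply f m = 0" "blinfun_apply f v \<noteq> 0"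
proof -
  have "M \<noteq> {}" using \<open>subspace M\<close> subspace_0 by blast
  define \<delta> where "\<delta> = infdist v M"
  have "\<delta> > 0"
    using assms \<open>M \<noteq> {}\<close> in_closure_iff_infdist_zero[of M v] infdist_nonneg[of v M] by (simp add: \<delta>_def)
  have "convex ((\<lambda>m. v - m) ` M)"
    using convex_translation[OF convex_negations[OF subspace_imp_convex[OF \<open>subspace M\<close>]], of v]
    by (simp add: image_image)
  moreover have "\<delta> \<le> norm c" if "c \<in> (\<lambda>m. v - m) ` M" for c
    using that infdist_le[of _ M v] by (auto simp: \<delta>_def dist_norm)
  ultimately obtain f :: "'a \<Rightarrow>\<^sub>L real"
    where f: "\<And>c. c \<in> (\<lambda>m. v - m) ` M \<Longrightarrow> \<delta> \<le> blinfun_apply f c"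
    using separate_convex_from_ball[of "(\<lambda>m. v - m) ` M" \<delta>] \<open>M \<noteq> {}\<close> by blast
  have le: "blinfun_apply f m \<le> blinfun_apply f v - \<delta>" if "m \<in> M" for m
    using f[of "v - m"] that by (auto simp: blinfun.diff_right)
  have nz: "blinfun_apply f m = 0" if "m \<in> M" for m
  proof (rule ccontr)
    assume nz: "blinfun_apply f m \<noteq> 0"
    \<comment> \<open>a linear functional bounded above on a subspace vanishes there\<close>
    define c where "c = blinfun_apply f v / blinfun_apply f m"
    have "blinfun_apply f (c *\<^sub>R m) = blinfun_apply f v"
      using nz by (simp add: c_def blinfun.scaleR_right)
    then show False
      using le[OF subspace_scale[OF \<open>subspace M\<close> that], of c] \<open>\<delta> > 0\<close> by simp
  qed
  moreover have "blinfun_apply f v \<noteq> 0"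
    using le[OF subspace_0[OF \<open>subspace M\<close>]] \<open>\<delta> > 0\<close> by (auto simp: blinfun.zero_right)
  ultimately show thesis using that by blast
qed

lemma bidual_embedding_apply: "blinfun_apply (bidual_embedding x) f = blinfun_apply f x"
  by transfer simp

lemma norm_bidual_embedding: "norm (bidual_embedding x) = norm x"
proof (rule antisym)
  show "norm (bidual_embedding x) \<le> norm x"
  proof (rule norm_blinfun_bound)
    show "norm (blinfun_apply (bidual_embedding x) f) \<le> norm x * norm f" for f
      using norm_blinfun[of f x] by (simp add: bidual_embedding_apply mult.commute)
  qed simp
  obtain f :: "'a \<Rightarrow>\<^sub>L real" where f: "norm f \<le> 1" "blinfun_apply f x = norm x"
    by (rule norming_functional)
  have "norm x \<le> norm (bidual_embedding x) * norm f"
    using norm_blinfun[of "bidual_embedding x" f] f by (simp add: bidual_embedding_apply)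
  also have "\<dots> \<le> norm (bidual_embedding x) * 1" using f by (intro mult_left_mono) auto
  finally show "norm x \<le> norm (bidual_embedding x)" by simp
qed

text \<open>A functional \<open>\<zeta>\<close> on the bidual is evaluation at its restriction to the space itself, because
  by reflexivity it has no further arguments.\<close>

lemma reflexive_dual:
  assumes "reflexive_space TYPE('a::real_normed_vector)"
  shows "reflexive_space TYPE('a \<Rightarrow>\<^sub>L real)"
  unfolding reflexive_space_def
proof (rule surjI)
  fix \<zeta> :: "(('a \<Rightarrow>\<^sub>L real) \<Rightarrow>\<^sub>L real) \<Rightarrow>\<^sub>L real"
  have lin: "bounded_linear (\<lambda>x::'a. blinfun_apply \<zeta> (bidual_embedding x))"
    by (rule bounded_linear_compose[OF blinfun.bounded_linear_right],
        rule bounded_linear_intro[where K = 1])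
      (auto intro!: blinfun_eqI simp: bidual_embedding_apply blinfun.bilinear_simps norm_bidual_embedding)
  show "bidual_embedding (Blinfun (\<lambda>x. blinfun_apply \<zeta> (bidual_embedding x))) = \<zeta>"
  proof (rule blinfun_eqI)
    fix F :: "('a \<Rightarrow>\<^sub>L real) \<Rightarrow>\<^sub>L real"
    obtain x where "F = bidual_embedding x"
      using assms unfolding reflexive_space_def by (metis surjE)
    then show "blinfun_apply (bidual_embedding (Blinfun (\<lambda>x. blinfun_apply \<zeta> (bidual_embedding x)))) F
        = blinfun_apply \<zeta> F"
      by (simp add: bidual_embedding_apply bounded_linear_Blinfun_apply[OF lin])
  qed
qed

section \<open>Simons' inequality\<close>

text \<open>
  A consequence of the proof of Simons' inequality. Choose \<open>g\<^sub>n\<close> in the convex hull of the tail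
  \<open>{S\<^sub>k | k \<ge> n}\<close> such that, with \<open>u\<^sub>n = \<Sum>\<^sub>j\<^sub><\<^sub>n g\<^sub>j / 2\<^sup>j\<^sup>+\<^sup>1\<close>, the vector \<open>v\<^sub>n = u\<^sub>n + g\<^sub>n / 2\<^sup>n\<close> has almost minimal
  norm. The competitor \<open>(g\<^sub>n + g\<^sub>n\<^sub>+\<^sub>1) / 2\<close> turns \<open>v\<^sub>n\<close> into \<open>v\<^sub>n\<^sub>+\<^sub>1\<close>, so the norms \<open>\<parallel>v\<^sub>n\<parallel>\<close> almost increase to
  \<open>\<parallel>z\<parallel>\<close>, where \<open>z = lim u\<^sub>n\<close>. Let \<open>l \<in> L\<close> attain the norm of \<open>z\<close>. As \<open>u\<^sub>n\<^sub>+\<^sub>1\<close> is the mean of \<open>u\<^sub>n\<close> and \<open>v\<^sub>n\<close>,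
  the values \<open>l(u\<^sub>n)\<close> approach \<open>\<parallel>z\<parallel>\<close> no faster than \<open>(1 - 2\<^sup>-\<^sup>n) \<parallel>z\<parallel>\<close> up to errors, whereas the
  remainder \<open>l(z - u\<^sub>n)\<close> is at most \<open>2\<^sup>-\<^sup>n\<close> times the supremum of \<open>l\<close> over the \<open>n\<close>-th tail, which is
  nearly \<open>0\<close> for large \<open>n\<close>. Hence \<open>\<parallel>z\<parallel>\<close> is small, and \<open>\<parallel>g\<^sub>0\<parallel> = \<parallel>v\<^sub>0\<parallel>\<close> hardly exceeds it.\<close>

theorem small_convex_combination:
  fixes S :: "nat \<Rightarrow> 'e::banach" and L :: "('e \<Rightarrow>\<^sub>L real) set"
  assumes bound: "\<And>n. norm (S n) \<le> M"
    and contr: "\<And>l. l \<in> L \<Longrightarrow> norm l \<le> 1"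
    and attain: "\<And>u. \<exists>l\<in>L. blinfun_apply l u = norm u"
    and null: "\<And>l. l \<in> L \<Longrightarrow> (\<lambda>n. blinfun_apply l (S n)) \<longlonglongrightarrow> 0"
    and "\<epsilon> > 0"
  shows "\<exists>g\<in>convex hull range S. norm g < \<epsilon>"
proof -
  define C where "C n = convex hull (S ` {n..})" for n
  \<comment> \<open>the errors below add up to at most \<open>5 \<eta>\<close>\<close>
  define \<eta> where "\<eta> = \<epsilon> / 8"
  have "\<eta> > 0" using \<open>\<epsilon> > 0\<close> by (simp add: \<eta>_def)
  have C_ne: "C n \<noteq> {}" for n by (auto simp: C_def)
  have C_conv: "convex (C n)" for n by (simp add: C_def)
  have C_Suc: "C (Suc n) \<subseteq> C n" for n unfolding C_def by (intro hull_mono image_mono) auto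
  have C_norm: "norm g \<le> M" if "g \<in> C n" for g n
  proof -
    have "C n \<subseteq> cball 0 M" unfolding C_def by (intro hull_minimal) (auto simp: bound)
    then show ?thesis using that by auto
  qed
  \<comment> \<open>\<open>G n w\<close> nearly minimises the norm of \<open>w + g / 2\<^sup>n\<close> over the \<open>n\<close>-th tail hull\<close>
  have "\<exists>g\<in>C n. \<forall>g'\<in>C n. norm (w + (1/2)^n *\<^sub>R g) \<le> norm (w + (1/2)^n *\<^sub>R g') + \<eta> * (1/4)^n" for n w
  proof -
    let ?f = "\<lambda>g. norm (w + (1/2)^n *\<^sub>R g)"
    have bdd: "bdd_below (?f ` C n)" by (rule bdd_belowI2[of _ 0]) simp
    have "Inf (?f ` C n) < Inf (?f ` C n) + \<eta> * (1/4)^n" using \<open>\<eta> > 0\<close> by simp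
    then obtain g where g: "g \<in> C n" "?f g < Inf (?f ` C n) + \<eta> * (1/4)^n"
      using cInf_lessD[of "?f ` C n"] C_ne by blast
    have "Inf (?f ` C n) \<le> ?f g'" if "g' \<in> C n" for g' by (rule cINF_lower[OF bdd that])
    then show ?thesis using g by (intro bexI[of _ g]) force+
  qed
  then obtain G where G: "\<And>n w. G n w \<in> C n"
    and Gmin: "\<And>n w g'. g' \<in> C n \<Longrightarrow>
      norm (w + (1/2)^n *\<^sub>R G n w) \<le> norm (w + (1/2)^n *\<^sub>R g') + \<eta> * (1/4)^n"
    by metis
  define u where "u = rec_nat 0 (\<lambda>n w. w + (1/2)^Suc n *\<^sub>R G n w)"
  define g where "g n = G n (u n)" for n
  define v where "v n = u n + (1/2)^n *\<^sub>R g n" for n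
  have u0: "u 0 = 0" and uSuc: "u (Suc n) = u n + (1/2)^Suc n *\<^sub>R g n" for n
    by (simp_all add: u_def g_def)
  have gC: "g n \<in> C n" for n by (simp add: g_def G)
  have v_step: "norm (v n) \<le> norm (v (Suc n)) + \<eta> * (1/4)^n" for n
  proof -
    have "(1/2) *\<^sub>R g n + (1/2) *\<^sub>R g (Suc n) \<in> C n"
      using gC[of n] gC[of "Suc n"] C_Suc[of n] by (intro convexD[OF C_conv]) auto
    from Gmin[OF this, of "u n"]
    have "norm (v n) \<le> norm (u n + (1/2)^n *\<^sub>R ((1/2) *\<^sub>R g n + (1/2) *\<^sub>R g (Suc n))) + \<eta> * (1/4)^n"
      by (simp only: v_def g_def)
    also have "u n + (1/2)^n *\<^sub>R ((1/2) *\<^sub>R g n + (1/2) *\<^sub>R g (Suc n)) = v (Suc n)"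
      by (simp add: v_def uSuc scaleR_add_right mult.commute)
    finally show ?thesis .
  qed
  have "summable (\<lambda>n. (1/2)^Suc n *\<^sub>R g n)"
  proof (rule summable_comparison_test'[of "\<lambda>n. M * (1/2)^Suc n" 0])
    show "summable (\<lambda>n. M * (1/2::real)^Suc n)"
      by (intro summable_mult summable_Suc_iff[THEN iffD2] summable_geometric) auto
    show "norm ((1/2)^Suc n *\<^sub>R g n) \<le> M * (1/2)^Suc n" for n
      using mult_right_mono[OF C_norm[OF gC[of n]], of "(1/2)^Suc n"] by (simp add: mult.commute)
  qed
  moreover have "u = (\<lambda>n. \<Sum>k<n. (1/2)^Suc k *\<^sub>R g k)"
  proof
    show "u n = (\<Sum>k<n. (1/2)^Suc k *\<^sub>R g k)" for n by (induction n) (auto simp: u0 uSuc)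
  qed
  ultimately obtain z where z: "u \<longlonglongrightarrow> z"
    using summable_LIMSEQ by metis
  have v_alt: "v n = 2 *\<^sub>R u (Suc n) - u n" for n
    by (simp add: v_def uSuc scaleR_add_right scaleR_2)
  have "v \<longlonglongrightarrow> 2 *\<^sub>R z - z"
    unfolding v_alt[abs_def] using z by (intro tendsto_intros LIMSEQ_Suc)
  then have vz: "v \<longlonglongrightarrow> z" by (simp add: scaleR_2)
  \<comment> \<open>\<open>(4/3) \<eta> 4\<^sup>-\<^sup>n\<close> is the sum of the errors \<open>\<eta> 4\<^sup>-\<^sup>j\<close> over \<open>j \<ge> n\<close>\<close>
  have v_le: "norm (v n) \<le> norm z + (4/3) * \<eta> * (1/4)^n" for n
  proof -
    have "incseq (\<lambda>n. norm (v n) - (4/3) * \<eta> * (1/4)^n)"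
      by (rule incseq_SucI) (use v_step in \<open>simp add: algebra_simps\<close>)
    moreover have "(\<lambda>n. norm (v n) - (4/3) * \<eta> * (1/4)^n) \<longlonglongrightarrow> norm z - (4/3) * \<eta> * 0"
      by (intro tendsto_intros tendsto_norm vz LIMSEQ_power_zero) auto
    ultimately show ?thesis using incseq_le[of _ "norm z - (4/3) * \<eta> * 0" n] by fastforce
  qed
  obtain l where l: "l \<in> L" "blinfun_apply l z = norm z" using attain by blast
  have l_le: "blinfun_apply l x \<le> norm x" for x
  proof -
    have "blinfun_apply l x \<le> norm l * norm x" using norm_blinfun[of l x] by simp
    also have "\<dots> \<le> 1 * norm x" using contr[OF l(1)] by (intro mult_right_mono) auto
    finally show ?thesis by simp
  qed
  \<comment> \<open>\<open>(8/3) \<eta> (1 - 2\<^sup>-\<^sup>n)\<close> is the sum of \<open>2\<^sup>j (4/3) \<eta> 4\<^sup>-\<^sup>j\<close> over \<open>j < n\<close>: the recursion doubles the scale\<close>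
  have lu: "blinfun_apply l (u n) \<le> norm z + (1/2)^n * ((8/3) * \<eta> * (1 - (1/2)^n) - norm z)" for n
  proof (induction n)
    case (Suc n)
    have "blinfun_apply l (u (Suc n)) = (blinfun_apply l (u n) + blinfun_apply l (v n)) / 2"
      by (simp add: v_alt blinfun.bilinear_simps)
    also have "\<dots> \<le> (norm z + (1/2)^n * ((8/3) * \<eta> * (1 - (1/2)^n) - norm z)
        + (norm z + (4/3) * \<eta> * (1/4)^n)) / 2"
      using Suc l_le[of "v n"] v_le[of n] by (intro divide_right_mono add_mono) auto
    also have "\<dots> = norm z + (1/2)^Suc n * ((8/3) * \<eta> * (1 - (1/2)^Suc n) - norm z)"
    proof -
      have "(1/4::real)^n = (1/2)^n * (1/2)^n" by (simp flip: power_mult_distrib)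
      then show ?thesis by (simp add: field_simps)
    qed
    finally show ?case .
  qed (simp add: u0 blinfun.bilinear_simps)
  obtain N where N: "\<And>n. n \<ge> N \<Longrightarrow> blinfun_apply l (S n) \<le> \<eta>"
    using LIMSEQ_D[OF null[OF l(1)] \<open>\<eta> > 0\<close>] by (auto simp: abs_less_iff) (metis less_imp_le)
  have lg: "blinfun_apply l x \<le> \<eta>" if "x \<in> C n" "n \<ge> N" for x n
  proof -
    have "convex {x. blinfun_apply l x \<le> \<eta>}"
      by (rule convexI) (auto simp: blinfun.bilinear_simps intro: convex_bound_le)
    then have "C n \<subseteq> {x. blinfun_apply l x \<le> \<eta>}"
      unfolding C_def using N that(2) by (intro hull_minimal) auto
    then show ?thesis using that by auto
  qed
  have tail: "blinfun_apply l (u (N + k)) \<le> blinfun_apply l (u N) + \<eta> * (1/2)^N * (1 - (1/2)^k)" for k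
  proof (induction k)
    case (Suc k)
    have "blinfun_apply l (u (N + Suc k))
        = blinfun_apply l (u (N + k)) + (1/2)^Suc (N + k) * blinfun_apply l (g (N + k))"
      by (simp add: uSuc blinfun.bilinear_simps)
    also have "\<dots> \<le> blinfun_apply l (u N) + \<eta> * (1/2)^N * (1 - (1/2)^k) + (1/2)^Suc (N + k) * \<eta>"
      using Suc lg[OF gC[of "N + k"]] by (intro add_mono mult_left_mono) auto
    also have "\<dots> = blinfun_apply l (u N) + \<eta> * (1/2)^N * (1 - (1/2)^Suc k)"
      by (simp add: power_add field_simps)
    finally show ?case .
  qed simp
  have "norm z \<le> blinfun_apply l (u N) + \<eta> * (1/2)^N"
  proof (rule LIMSEQ_le_const2)
    show "(\<lambda>k. blinfun_apply l (u (N + k))) \<longlonglongrightarrow> norm z"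
      using blinfun.tendsto[OF tendsto_const LIMSEQ_ignore_initial_segment[OF z, of N], of l] l(2)
      by (simp add: add.commute)
    have "blinfun_apply l (u (N + k)) \<le> blinfun_apply l (u N) + \<eta> * (1/2)^N" for k
    proof -
      have "\<eta> * (1/2)^N * (1 - (1/2)^k) \<le> \<eta> * (1/2)^N * 1"
        using \<open>\<eta> > 0\<close> by (intro mult_left_mono) auto
      then show ?thesis using tail[of k] by linarith
    qed
    then show "\<exists>K. \<forall>k\<ge>K. blinfun_apply l (u (N + k)) \<le> blinfun_apply l (u N) + \<eta> * (1/2)^N"
      by blast
  qed
  also have "\<dots> \<le> norm z + (1/2)^N * ((8/3) * \<eta> * (1 - (1/2)^N) - norm z + \<eta>)"
    using lu[of N] by (simp add: algebra_simps)
  finally have "0 \<le> (1/2)^N * ((8/3) * \<eta> * (1 - (1/2)^N) - norm z + \<eta>)" by linarith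
  moreover have "(0::real) < (1/2)^N" by simp
  ultimately have "0 \<le> (8/3) * \<eta> * (1 - (1/2)^N) - norm z + \<eta>"
    by (meson mult_pos_neg not_le)
  moreover have "(8/3) * \<eta> * (1 - (1/2)^N) \<le> (8/3) * \<eta> * 1"
    using \<open>\<eta> > 0\<close> by (intro mult_left_mono) auto
  ultimately have "norm z \<le> (11/3) * \<eta>" by simp
  then have "norm (g 0) \<le> 5 * \<eta>" using v_le[of 0] by (simp add: v_def u0)
  then have "norm (g 0) < \<epsilon>" using \<open>\<epsilon> > 0\<close> by (simp add: \<eta>_def)
  moreover have "g 0 \<in> convex hull range S" using gC[of 0] by (simp add: C_def atLeast_0)
  ultimately show ?thesis by blast
qed

section \<open>Compact operators and convex sets of operators\<close>

text \<open>
  The norm attains its maximum \<open>\<parallel>U\<parallel>\<close> over the compact closure of the image of the ball at some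
  \<open>z\<close>. If \<open>f\<close> norms \<open>z\<close>, then \<open>\<parallel>f \<circ> U\<parallel> = \<parallel>U\<parallel>\<close>, and \<open>\<Psi>\<close> is a functional norming \<open>f \<circ> U\<close>.\<close>

lemma compact_operator_attains_norm:
  fixes U :: "'x::real_normed_vector \<Rightarrow>\<^sub>L 'z::real_normed_vector"
  assumes "compact_operator U"
  obtains \<Psi> :: "('x \<Rightarrow>\<^sub>L real) \<Rightarrow>\<^sub>L real" and f :: "'z \<Rightarrow>\<^sub>L real"
  where "norm \<Psi> \<le> 1" "norm f \<le> 1" "blinfun_apply \<Psi> (f o\<^sub>L U) = norm U"
proof -
  define K where "K = closure (blinfun_apply U ` cball 0 1)"
  have UK: "blinfun_apply U x \<in> K" if "norm x \<le> 1" for x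
    using closure_subset that by (fastforce simp: K_def)
  have "compact K" using assms by (simp add: K_def compact_operator_def)
  moreover have "K \<noteq> {}" using UK[of 0] by auto
  ultimately obtain z where z: "z \<in> K" "\<And>w. w \<in> K \<Longrightarrow> norm w \<le> norm z"
    using continuous_attains_sup[of K norm] by (auto intro: continuous_intros)
  have U_le: "norm U \<le> norm z"
  proof (rule norm_blinfun_bound)
    fix x
    show "norm (blinfun_apply U x) \<le> norm z * norm x"
    proof (cases "x = 0")
      case False
      have "norm (blinfun_apply U (x /\<^sub>R norm x)) \<le> norm z"
        using False by (intro z(2) UK) simp
      then show ?thesis using False by (simp add: blinfun.scaleR_right field_simps)
    qed (simp add: blinfun.zero_right)
  qed simp
  obtain f :: "'z \<Rightarrow>\<^sub>L real" where f: "norm f \<le> 1" "blinfun_apply f z = norm z"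
    by (rule norming_functional)
  have "blinfun_apply U ` cball 0 1 \<subseteq> {w. blinfun_apply f w \<le> norm (f o\<^sub>L U)}"
  proof clarify
    fix x :: 'x assume "x \<in> cball 0 1"
    then have "norm (f o\<^sub>L U) * norm x \<le> norm (f o\<^sub>L U) * 1" by (intro mult_left_mono) auto
    then show "blinfun_apply f (blinfun_apply U x) \<le> norm (f o\<^sub>L U)"
      using norm_blinfun[of "f o\<^sub>L U" x] by simp
  qed
  moreover have "closed {w. blinfun_apply f w \<le> norm (f o\<^sub>L U)}"
    by (intro closed_Collect_le continuous_intros)
  ultimately have "K \<subseteq> {w. blinfun_apply f w \<le> norm (f o\<^sub>L U)}"
    unfolding K_def by (rule closure_minimal)
  then have "norm U \<le> norm (f o\<^sub>L U)" using z(1) f(2) U_le by auto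
  moreover have "norm (f o\<^sub>L U) \<le> norm U"
    using norm_blinfun_compose[of f U] mult_right_mono[OF f(1), of "norm U"] by simp
  ultimately have "norm (f o\<^sub>L U) = norm U" by simp
  moreover obtain \<Psi> :: "('x \<Rightarrow>\<^sub>L real) \<Rightarrow>\<^sub>L real"
    where "norm \<Psi> \<le> 1" "blinfun_apply \<Psi> (f o\<^sub>L U) = norm (f o\<^sub>L U)"
    by (rule norming_functional)
  ultimately show thesis using that f(1) by metis
qed

text \<open>Compact sets are separable: norming functionals of a countable dense subset suffice.\<close>

lemma compact_set_normed_by_sequence:
  fixes K :: "'z::real_normed_vector set"
  assumes "compact K"
  obtains e :: "nat \<Rightarrow> 'z \<Rightarrow>\<^sub>L real"
  where "\<And>k. norm (e k) \<le> 1"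
    and "\<And>z \<eta>. z \<in> K \<Longrightarrow> \<eta> > 0 \<Longrightarrow> \<exists>k. norm z - \<eta> \<le> blinfun_apply (e k) z"
proof -
  have "\<exists>F. finite F \<and> F \<subseteq> K \<and> K \<subseteq> (\<Union>q\<in>F. ball q (1 / real (Suc n)))" for n
    using assms by (intro seq_compact_imp_totally_bounded[rule_format] compact_imp_seq_compact) auto
  then obtain F where F: "\<And>n. finite (F n)" "\<And>n. K \<subseteq> (\<Union>q\<in>F n. ball q (1 / real (Suc n)))"
    by metis
  \<comment> \<open>\<open>0\<close> only serves to make the set nonempty when \<open>K\<close> is empty\<close>
  define Q where "Q = insert 0 (\<Union>n. F n)"
  have Q: "countable Q" "Q \<noteq> {}" using F(1) by (auto simp: Q_def intro: countable_finite)
  have "\<exists>f :: 'z \<Rightarrow>\<^sub>L real. norm f \<le> 1 \<and> blinfun_apply f q = norm q" for q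
    by (metis norming_functional)
  then obtain J :: "'z \<Rightarrow> 'z \<Rightarrow>\<^sub>L real"
    where J: "\<And>q. norm (J q) \<le> 1" "\<And>q. blinfun_apply (J q) q = norm q" by metis
  show thesis
  proof
    show "norm (J (from_nat_into Q k)) \<le> 1" for k by (rule J)
    fix z and \<eta> :: real assume "z \<in> K" "\<eta> > 0"
    then have "\<eta> / 2 > 0" by simp
    then obtain n where n: "1 / real (Suc n) < \<eta> / 2" using nat_approx_posE by blast
    obtain q where q: "q \<in> F n" "dist q z < 1 / real (Suc n)" using F(2)[of n] \<open>z \<in> K\<close> by auto
    then have "q \<in> Q" by (auto simp: Q_def)
    then obtain k where k: "from_nat_into Q k = q" using from_nat_into_surj[OF Q(1)] by blast
    have "blinfun_apply (J q) (q - z) \<le> norm (J q) * norm (q - z)"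
      using norm_blinfun[of "J q" "q - z"] by simp
    also have "\<dots> \<le> 1 * norm (q - z)" by (intro mult_right_mono J) auto
    finally have "norm q - norm (q - z) \<le> blinfun_apply (J q) z"
      by (simp add: blinfun.diff_right J)
    moreover have "norm z \<le> norm q + norm (q - z)"
      using norm_triangle_sub[of z q] by (simp add: norm_minus_commute)
    ultimately have "norm z - \<eta> \<le> blinfun_apply (J q) z"
      using q(2) n unfolding dist_norm by linarith
    then show "\<exists>k. norm z - \<eta> \<le> blinfun_apply (J (from_nat_into Q k)) z" using k by metis
  qed
qed

text \<open>\<open>0\<close> lies in the closure of \<open>A\<close> for the topology of the functionals \<open>T \<mapsto> \<Psi>(f \<circ> T)\<close>.\<close>

definition zero_adherent ::
  "('x::real_normed_vector \<Rightarrow>\<^sub>L 'z::real_normed_vector) set \<Rightarrow> bool" where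
  "zero_adherent A \<longleftrightarrow>
     (\<forall>Q. \<forall>\<delta>>0. finite Q \<longrightarrow>
       (\<exists>T\<in>A. \<forall>(\<Psi> :: ('x \<Rightarrow>\<^sub>L real) \<Rightarrow>\<^sub>L real, f :: 'z \<Rightarrow>\<^sub>L real)\<in>Q.
          \<bar>blinfun_apply \<Psi> (f o\<^sub>L T)\<bar> < \<delta>))"

lemma zero_adherentD:
  fixes A :: "('x::real_normed_vector \<Rightarrow>\<^sub>L 'z::real_normed_vector) set"
    and Q :: "((('x \<Rightarrow>\<^sub>L real) \<Rightarrow>\<^sub>L real) \<times> ('z \<Rightarrow>\<^sub>L real)) set"
  assumes "zero_adherent A" "finite Q" "\<delta> > 0"
  obtains T where "T \<in> A" "\<And>\<Psi> f. (\<Psi>, f) \<in> Q \<Longrightarrow> \<bar>blinfun_apply \<Psi> (f o\<^sub>L T)\<bar> < \<delta>"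
proof -
  from assms have "\<exists>T\<in>A. \<forall>(\<Psi>, f)\<in>Q. \<bar>blinfun_apply \<Psi> (f o\<^sub>L T)\<bar> < \<delta>"
    by (simp add: zero_adherent_def)
  then show thesis using that by auto
qed

lemma convex_small_bounded_linear:
  fixes h :: "'a::real_normed_vector \<Rightarrow> 'b::real_normed_vector"
  assumes "bounded_linear h"
  shows "convex {T. norm (h T) < \<delta>}"
proof -
  have "{T. norm (h T) < \<delta>} = h -` ball 0 \<delta>" by auto
  then show ?thesis
    using convex_linear_vimage[OF bounded_linear.linear[OF assms] convex_ball] by metis
qed

text \<open>
  Mazur's theorem, localised: the members of \<open>A\<close> in a convex weak neighbourhood of \<open>0\<close> form a convex set
  whose image under \<open>T \<mapsto> f \<circ> T\<close> has \<open>0\<close> in its weak closure, hence in its norm closure. Keeping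
  adherence in the conclusion makes it possible to treat several \<open>f\<close> one after the other.\<close>

lemma zero_adherent_small_composition:
  fixes A :: "('x::real_normed_vector \<Rightarrow>\<^sub>L 'z::real_normed_vector) set"
    and f :: "'z \<Rightarrow>\<^sub>L real"
  assumes "convex A" "zero_adherent A" "\<delta> > 0"
  shows "zero_adherent {T \<in> A. norm (f o\<^sub>L T) < \<delta>}"
  unfolding zero_adherent_def
proof (intro allI impI)
  fix Q :: "((('x \<Rightarrow>\<^sub>L real) \<Rightarrow>\<^sub>L real) \<times> ('z \<Rightarrow>\<^sub>L real)) set" and \<epsilon> :: real
  assume "\<epsilon> > 0" "finite Q"
  define B where "B = {T \<in> A. \<forall>(\<Psi>, f)\<in>Q. \<bar>blinfun_apply \<Psi> (f o\<^sub>L T)\<bar> < \<epsilon>}"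
  have lin: "bounded_linear (\<lambda>T :: 'x \<Rightarrow>\<^sub>L 'z. f o\<^sub>L T)" for f :: "'z \<Rightarrow>\<^sub>L real"
    by (rule bounded_bilinear.bounded_linear_right[OF bounded_bilinear_blinfun_compose])
  have "B = A \<inter> (\<Inter>(\<Psi>, f)\<in>Q. {T. norm (blinfun_apply \<Psi> (f o\<^sub>L T)) < \<epsilon>})"
    by (auto simp: B_def)
  moreover have "convex {T. norm (blinfun_apply \<Psi> (f o\<^sub>L T)) < \<epsilon>}" for \<Psi> :: "('x \<Rightarrow>\<^sub>L real) \<Rightarrow>\<^sub>L real" and f :: "'z \<Rightarrow>\<^sub>L real"
    by (intro convex_small_bounded_linear bounded_linear_compose[OF blinfun.bounded_linear_right lin])
  ultimately have "convex B" using \<open>convex A\<close> by (auto intro!: convex_Int convex_INT)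
  have "\<exists>T\<in>B. norm (f o\<^sub>L T) < \<delta>"
  proof (rule ccontr)
    assume far: "\<not> ?thesis"
    define C where "C = (\<lambda>T. f o\<^sub>L T) ` B"
    have "convex C"
      unfolding C_def by (rule convex_linear_image[OF bounded_linear.linear[OF lin] \<open>convex B\<close>])
    moreover obtain T0 where "T0 \<in> A" "\<And>\<Psi> f. (\<Psi>, f) \<in> Q \<Longrightarrow> \<bar>blinfun_apply \<Psi> (f o\<^sub>L T0)\<bar> < \<epsilon>"
      using zero_adherentD[OF \<open>zero_adherent A\<close> \<open>finite Q\<close> \<open>\<epsilon> > 0\<close>] by blast
    then have "T0 \<in> B" by (auto simp: B_def)
    then have "B \<noteq> {}" by blast
    then have "C \<noteq> {}" by (simp add: C_def)
    moreover have "\<delta> \<le> norm c" if "c \<in> C" for c using that far by (auto simp: C_def not_less)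
    ultimately obtain \<Psi> :: "('x \<Rightarrow>\<^sub>L real) \<Rightarrow>\<^sub>L real"
      where \<Psi>: "\<And>c. c \<in> C \<Longrightarrow> \<delta> \<le> blinfun_apply \<Psi> c"
      using separate_convex_from_ball[of C \<delta>] by blast
    have "finite (insert (\<Psi>, f) Q)" "min \<epsilon> \<delta> > 0"
      using \<open>finite Q\<close> \<open>\<epsilon> > 0\<close> \<open>\<delta> > 0\<close> by auto
    then obtain T where T: "T \<in> A"
      "\<And>\<Psi>' f'. (\<Psi>', f') \<in> insert (\<Psi>, f) Q \<Longrightarrow> \<bar>blinfun_apply \<Psi>' (f' o\<^sub>L T)\<bar> < min \<epsilon> \<delta>"
      using zero_adherentD[OF \<open>zero_adherent A\<close>] by metis
    have "T \<in> B" using T by (auto simp: B_def)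
    then have "\<delta> \<le> blinfun_apply \<Psi> (f o\<^sub>L T)" by (intro \<Psi>) (simp add: C_def)
    then show False using T(2)[of \<Psi> f] by force
  qed
  then show "\<exists>T\<in>{T \<in> A. norm (f o\<^sub>L T) < \<delta>}. \<forall>(\<Psi>, f)\<in>Q. \<bar>blinfun_apply \<Psi> (f o\<^sub>L T)\<bar> < \<epsilon>"
    by (auto simp: B_def)
qed

lemma zero_adherent_small_compositions:
  fixes A :: "('x::real_normed_vector \<Rightarrow>\<^sub>L 'z::real_normed_vector) set"
    and D :: "('z \<Rightarrow>\<^sub>L real) set"
  assumes "convex A" "zero_adherent A" "\<delta> > 0" "finite D"
  obtains T where "T \<in> A" "\<And>f. f \<in> D \<Longrightarrow> norm (f o\<^sub>L T) < \<delta>"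
proof -
  define B where "B D = {T \<in> A. \<forall>f\<in>D. norm (f o\<^sub>L T) < \<delta>}" for D :: "('z \<Rightarrow>\<^sub>L real) set"
  have "convex (B D) \<and> zero_adherent (B D)"
    using \<open>finite D\<close>
  proof (induction D)
    case empty
    then show ?case using assms by (simp add: B_def)
  next
    case (insert f D)
    have eq: "B (insert f D) = {T \<in> B D. norm (f o\<^sub>L T) < \<delta>}" by (auto simp: B_def)
    have "convex {T :: 'x \<Rightarrow>\<^sub>L 'z. norm (f o\<^sub>L T) < \<delta>}"
      by (intro convex_small_bounded_linear
          bounded_bilinear.bounded_linear_right[OF bounded_bilinear_blinfun_compose])
    then have "convex (B (insert f D))"
      using insert.IH unfolding eq by (simp add: Collect_conj_eq convex_Int)
    then show ?case using zero_adherent_small_composition[of "B D" \<delta> f] insert.IH \<open>\<delta> > 0\<close> by (simp add: eq)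
  qed
  then obtain T where "T \<in> B D"
    using zero_adherentD[OF _ finite.emptyI \<open>\<delta> > 0\<close>] by blast
  then show thesis using that by (auto simp: B_def)
qed

text \<open>
  These sets exhaust the span of the ranges of the \<open>S\<^sub>k\<close> up to scaling, lie in compact sets if the \<open>S\<^sub>k\<close>
  are compact, and depend only on the first \<open>n\<close> operators, so that they can be used while a
  sequence is still being constructed.\<close>

definition ball_sums :: "(nat \<Rightarrow> 'x::real_normed_vector \<Rightarrow>\<^sub>L 'z::real_normed_vector) \<Rightarrow> nat \<Rightarrow> 'z set" where
  "ball_sums S n = {\<Sum>k<n. blinfun_apply (S k) (x k) | x. \<forall>k. norm (x k) \<le> 1}"

lemma ball_sums_cong:
  "(\<And>k. k < n \<Longrightarrow> S k = S' k) \<Longrightarrow> ball_sums S n = ball_sums S' n"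
  by (auto simp: ball_sums_def intro!: sum.cong)

lemma ball_sums_in_compact:
  fixes S :: "nat \<Rightarrow> 'x::real_normed_vector \<Rightarrow>\<^sub>L 'z::real_normed_vector"
  assumes "\<And>k. compact_operator (S k)"
  obtains K where "compact K" "ball_sums S n \<subseteq> K"
proof -
  have "\<exists>K. compact K \<and> ball_sums S n \<subseteq> K"
  proof (induction n)
    case 0
    then show ?case by (intro exI[of _ "{0}"]) (auto simp: ball_sums_def)
  next
    case (Suc n)
    then obtain K where K: "compact K" "ball_sums S n \<subseteq> K" by blast
    let ?L = "closure (blinfun_apply (S n) ` cball 0 1)"
    have "compact {v + w | v w. v \<in> K \<and> w \<in> ?L}"
      using K assms[of n] by (intro compact_sums) (auto simp: compact_operator_def)
    moreover have "ball_sums S (Suc n) \<subseteq> {v + w | v w. v \<in> K \<and> w \<in> ?L}"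
    proof
      fix z assume "z \<in> ball_sums S (Suc n)"
      then obtain x where x: "\<forall>k. norm (x k) \<le> 1" "z = (\<Sum>k<n. blinfun_apply (S k) (x k)) + blinfun_apply (S n) (x n)"
        by (auto simp: ball_sums_def)
      have "(\<Sum>k<n. blinfun_apply (S k) (x k)) \<in> K" using x(1) K(2) by (auto simp: ball_sums_def)
      moreover have "blinfun_apply (S n) (x n) \<in> ?L" using x(1) by (intro closure_subset[THEN subsetD]) auto
      ultimately show "z \<in> {v + w | v w. v \<in> K \<and> w \<in> ?L}" using x(2) by blast
    qed
    ultimately show ?case by blast
  qed
  then show thesis using that by blast
qed

lemma span_ranges_ball_sums:
  fixes S :: "nat \<Rightarrow> 'x::real_normed_vector \<Rightarrow>\<^sub>L 'z::real_normed_vector"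
  assumes "w \<in> span (\<Union>k. range (blinfun_apply (S k)))"
  obtains r n where "r > 0" "r *\<^sub>R w \<in> ball_sums S n"
proof -
  define W where
    "W = {w. \<exists>n x. w = (\<Sum>k<n. blinfun_apply (S k) (x k)) \<and> (\<forall>k. k \<ge> n \<longrightarrow> x k = 0)}"
  have W_I: "w \<in> W" if "w = (\<Sum>k<n. blinfun_apply (S k) (x k))" "\<And>k. k \<ge> n \<Longrightarrow> x k = 0" for w n x
    unfolding W_def using that by blast
  have W_E: "\<exists>n x. w = (\<Sum>k<n. blinfun_apply (S k) (x k)) \<and> (\<forall>k. k \<ge> n \<longrightarrow> x k = 0)" if "w \<in> W" for w
    using that unfolding W_def by (rule CollectD)
  \<comment> \<open>the vanishing of \<open>x\<^sub>k\<close> for \<open>k \<ge> n\<close> lets sums of different length be added\<close>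
  have extend: "(\<Sum>k<n + m. blinfun_apply (S k) (x k)) = (\<Sum>k<n. blinfun_apply (S k) (x k))"
    if "\<forall>k. k \<ge> n \<longrightarrow> x k = 0" for n m x
    by (rule sum.mono_neutral_right) (use that in \<open>auto simp: blinfun.zero_right\<close>)
  have "subspace W"
  proof (rule subspaceI)
    show "0 \<in> W" by (rule W_I[where n = 0 and x = "\<lambda>_. 0"]) auto
    show "v + w \<in> W" if vw: "v \<in> W" "w \<in> W" for v w
    proof -
      obtain n x where x: "v = (\<Sum>k<n. blinfun_apply (S k) (x k))" "\<forall>k. k \<ge> n \<longrightarrow> x k = 0"
        using W_E[OF vw(1)] by (elim exE conjE)
      obtain m y where y: "w = (\<Sum>k<m. blinfun_apply (S k) (y k))" "\<forall>k. k \<ge> m \<longrightarrow> y k = 0"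
        using W_E[OF vw(2)] by (elim exE conjE)
      show ?thesis
      proof (rule W_I)
        show "v + w = (\<Sum>k<n + m. blinfun_apply (S k) (x k + y k))"
          using extend[OF x(2), of m] extend[OF y(2), of n]
          by (simp add: x(1) y(1) blinfun.add_right sum.distrib add.commute)
      qed (use x(2) y(2) in simp)
    qed
    show "c *\<^sub>R w \<in> W" if w: "w \<in> W" for c w
    proof -
      obtain n x where x: "w = (\<Sum>k<n. blinfun_apply (S k) (x k))" "\<forall>k. k \<ge> n \<longrightarrow> x k = 0"
        using W_E[OF w] by (elim exE conjE)
      show ?thesis
      proof (rule W_I)
        show "c *\<^sub>R w = (\<Sum>k<n. blinfun_apply (S k) (c *\<^sub>R x k))"
          by (simp add: x(1) blinfun.scaleR_right scaleR_sum_right)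
      qed (use x(2) in simp)
    qed
  qed
  moreover have "(\<Union>k. range (blinfun_apply (S k))) \<subseteq> W"
  proof clarify
    fix k x
    show "blinfun_apply (S k) x \<in> W"
    proof (rule W_I)
      have "(\<Sum>j<Suc k. blinfun_apply (S j) (if j = k then x else 0))
          = (\<Sum>j<Suc k. if j = k then blinfun_apply (S j) x else 0)"
        by (rule sum.cong) (auto simp: blinfun.zero_right)
      then show "blinfun_apply (S k) x = (\<Sum>j<Suc k. blinfun_apply (S j) (if j = k then x else 0))"
        by simp
    qed simp
  qed
  ultimately have "w \<in> W" using assms span_minimal by blast
  then obtain n x where x: "w = (\<Sum>k<n. blinfun_apply (S k) (x k))" "\<forall>k. k \<ge> n \<longrightarrow> x k = 0"
    using W_E by metis
  define R where "R = 1 + (\<Sum>k<n. norm (x k))"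
  have "R \<ge> 1" by (simp add: R_def sum_nonneg)
  have x_le: "norm (x k) \<le> R" for k
  proof (cases "k < n")
    case True
    then show ?thesis using member_le_sum[of k "{..<n}" "\<lambda>k. norm (x k)"] by (simp add: R_def)
  qed (use x(2) \<open>R \<ge> 1\<close> in simp)
  have "inverse R *\<^sub>R w = (\<Sum>k<n. blinfun_apply (S k) (inverse R *\<^sub>R x k))"
    by (simp add: x(1) blinfun.scaleR_right scaleR_sum_right)
  moreover have "norm (inverse R *\<^sub>R x k) \<le> 1" for k
    using x_le[of k] \<open>R \<ge> 1\<close> by (simp add: field_simps)
  ultimately have "inverse R *\<^sub>R w \<in> ball_sums S n"
    unfolding ball_sums_def by (intro CollectI exI[of _ "\<lambda>k. inverse R *\<^sub>R x k"] conjI allI)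
  moreover have "inverse R > 0" using \<open>R \<ge> 1\<close> by simp
  ultimately show thesis using that by blast
qed

section \<open>From weak to norm adherence\<close>

text \<open>The elementary tensor \<open>\<Psi> \<otimes> f \<in> X\<^sup>*\<^sup>* \<otimes> Z\<^sup>*\<close> acting on operators from \<open>X\<close> to \<open>Z\<close>.\<close>

lift_definition bidual_tensor ::
  "(('x::real_normed_vector \<Rightarrow>\<^sub>L real) \<Rightarrow>\<^sub>L real) \<Rightarrow> ('z::real_normed_vector \<Rightarrow>\<^sub>L real)
    \<Rightarrow> ('x \<Rightarrow>\<^sub>L 'z) \<Rightarrow>\<^sub>L real"
  is "\<lambda>\<Psi> f T. blinfun_apply \<Psi> (f o\<^sub>L T)"
  by (intro bounded_linear_compose[OF blinfun.bounded_linear_right]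
      bounded_bilinear.bounded_linear_right[OF bounded_bilinear_blinfun_compose])

lemma bidual_tensor_le: "\<bar>blinfun_apply \<Psi> (f o\<^sub>L T)\<bar> \<le> norm \<Psi> * norm f * norm T"
proof -
  have "\<bar>blinfun_apply \<Psi> (f o\<^sub>L T)\<bar> \<le> norm \<Psi> * norm (f o\<^sub>L T)"
    using norm_blinfun[of \<Psi> "f o\<^sub>L T"] by simp
  also have "\<dots> \<le> norm \<Psi> * (norm f * norm T)"
    by (intro mult_left_mono norm_blinfun_compose) auto
  finally show ?thesis by (simp add: mult.assoc)
qed

lemma norm_bidual_tensor_le: "norm (bidual_tensor \<Psi> f) \<le> norm \<Psi> * norm f"
  by (rule norm_blinfun_bound) (auto simp: bidual_tensor.rep_eq bidual_tensor_le)

text \<open>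
  Functionals \<open>f\<close> with \<open>\<parallel>f \<circ> S\<^sub>n\<parallel> \<rightarrow> 0\<close> form a closed subspace \<open>Y\<close> of \<open>Z\<^sup>*\<close>. If \<open>Y\<close> were proper, then by Hahn-Banach and
  reflexivity some nonzero \<open>z \<in> Z\<close> would be annihilated by \<open>Y\<close>. Since \<open>Y\<close> contains all functionals
  vanishing on the ranges of the \<open>S\<^sub>n\<close>, that \<open>z\<close> lies in the closed span of these ranges; there
  the functionals \<open>e\<^sub>i\<^sub>k \<in> Y\<close> are norming, so \<open>z = 0\<close>.\<close>

lemma null_on_norming_imp_null:
  fixes S :: "nat \<Rightarrow> 'x::real_normed_vector \<Rightarrow>\<^sub>L 'z::real_normed_vector"
    and e :: "nat \<Rightarrow> nat \<Rightarrow> 'z \<Rightarrow>\<^sub>L real" and f :: "'z \<Rightarrow>\<^sub>L real"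
  assumes "reflexive_space TYPE('z)"
    and bound: "\<And>n. norm (S n) \<le> M"
    and e_norm: "\<And>i k. norm (e i k) \<le> 1"
    and e: "\<And>i z \<eta>. z \<in> ball_sums S i \<Longrightarrow> \<eta> > 0 \<Longrightarrow> \<exists>k. norm z - \<eta> \<le> blinfun_apply (e i k) z"
    and null: "\<And>i k. (\<lambda>n. e i k o\<^sub>L S n) \<longlonglongrightarrow> 0"
  shows "(\<lambda>n. f o\<^sub>L S n) \<longlonglongrightarrow> 0"
proof (rule ccontr)
  assume f: "\<not> (\<lambda>n. f o\<^sub>L S n) \<longlonglongrightarrow> 0"
  define Y where "Y = {f :: 'z \<Rightarrow>\<^sub>L real. (\<lambda>n. f o\<^sub>L S n) \<longlonglongrightarrow> 0}"
  note comp = bounded_bilinear_blinfun_compose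
  have "subspace Y"
  proof (rule subspaceI)
    show "0 \<in> Y" by (simp add: Y_def bounded_bilinear.zero_left[OF comp])
    show "f + g \<in> Y" if "f \<in> Y" "g \<in> Y" for f g
      using tendsto_add[of "\<lambda>n. f o\<^sub>L S n" 0 _ "\<lambda>n. g o\<^sub>L S n" 0] that
      by (simp add: Y_def bounded_bilinear.add_left[OF comp])
    show "c *\<^sub>R f \<in> Y" if "f \<in> Y" for c f
      using tendsto_scaleR[OF tendsto_const, of "\<lambda>n. f o\<^sub>L S n" 0 _ c] that
      by (simp add: Y_def bounded_bilinear.scaleR_left[OF comp])
  qed
  have "M \<ge> 0" using bound[of 0] norm_ge_zero order_trans by blast
  have "closed Y"
    unfolding closed_sequential_limits
  proof (intro allI impI, elim conjE)
    fix h and h' :: "'z \<Rightarrow>\<^sub>L real" assume h: "\<forall>m. h m \<in> Y" "h \<longlonglongrightarrow> h'"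
    have "(\<lambda>n. h' o\<^sub>L S n) \<longlonglongrightarrow> 0"
    proof (rule LIMSEQ_I)
      fix r :: real assume "r > 0"
      then have "r / 2 / (M + 1) > 0" using \<open>M \<ge> 0\<close> by simp
      then obtain m where m: "norm (h m - h') < r / 2 / (M + 1)"
        using LIMSEQ_D[OF h(2)] by blast
      have "(\<lambda>n. h m o\<^sub>L S n) \<longlonglongrightarrow> 0" using h(1) by (simp add: Y_def)
      from LIMSEQ_D[OF this, of "r / 2"] \<open>r > 0\<close>
      obtain N where N: "\<And>n. n \<ge> N \<Longrightarrow> norm (h m o\<^sub>L S n) < r / 2" by auto
      have "norm (h' o\<^sub>L S n) < r" if "n \<ge> N" for n
      proof -
        have "norm ((h m - h') o\<^sub>L S n) \<le> norm (h m - h') * norm (S n)"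
          by (rule norm_blinfun_compose)
        also have "\<dots> \<le> norm (h m - h') * (M + 1)"
          using bound[of n] by (intro mult_left_mono) auto
        also have "\<dots> < r / 2" using m \<open>M \<ge> 0\<close> by (simp add: pos_less_divide_eq algebra_simps)
        finally have "norm ((h m - h') o\<^sub>L S n) < r / 2" .
        moreover have "h' o\<^sub>L S n = (h m o\<^sub>L S n) - ((h m - h') o\<^sub>L S n)"
          by (simp add: bounded_bilinear.diff_left[OF comp])
        ultimately show ?thesis
          using N[OF that] norm_triangle_ineq4[of "h m o\<^sub>L S n" "(h m - h') o\<^sub>L S n"] by simp
      qed
      then show "\<exists>N. \<forall>n\<ge>N. norm ((h' o\<^sub>L S n) - 0) < r" by auto
    qed
    then show "h' \<in> Y" by (simp add: Y_def)
  qed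
  have "f \<notin> Y" using f by (simp add: Y_def)
  obtain \<zeta> :: "('z \<Rightarrow>\<^sub>L real) \<Rightarrow>\<^sub>L real"
    where \<zeta>: "\<And>h. h \<in> Y \<Longrightarrow> blinfun_apply \<zeta> h = 0" "blinfun_apply \<zeta> f \<noteq> 0"
    using separate_point_from_subspace[OF \<open>subspace Y\<close>] \<open>f \<notin> Y\<close> \<open>closed Y\<close> by (metis closure_closed)
  obtain z where "\<zeta> = bidual_embedding z"
    using \<open>reflexive_space TYPE('z)\<close> unfolding reflexive_space_def by (metis surjE)
  then have z: "\<And>h. h \<in> Y \<Longrightarrow> blinfun_apply h z = 0" "blinfun_apply f z \<noteq> 0"
    using \<zeta> by (auto simp: bidual_embedding_apply)
  define W where "W = span (\<Union>k. range (blinfun_apply (S k)))"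
  have "z \<in> closure W"
  proof (rule ccontr)
    assume "z \<notin> closure W"
    moreover have "subspace W" by (simp add: W_def)
    ultimately obtain h :: "'z \<Rightarrow>\<^sub>L real"
      where h: "\<And>w. w \<in> W \<Longrightarrow> blinfun_apply h w = 0" "blinfun_apply h z \<noteq> 0"
      using separate_point_from_subspace by blast
    have "blinfun_apply (S n) x \<in> W" for n x by (auto simp: W_def intro: span_base)
    then have "h o\<^sub>L S n = 0" for n by (intro blinfun_eqI) (simp add: h(1))
    then have "h \<in> Y" by (simp add: Y_def)
    then show False using z(1) h(2) by blast
  qed
  \<comment> \<open>the \<open>e\<^sub>i\<^sub>k\<close> vanish at \<open>z\<close> and norm every \<open>w\<close> in the span, hence \<open>\<parallel>w\<parallel>\<close> is at most about \<open>\<parallel>w - z\<parallel>\<close>\<close>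
  have "norm z \<le> 0 + \<epsilon>" if "\<epsilon> > 0" for \<epsilon>
  proof -
    define \<eta> where "\<eta> = \<epsilon> / 3"
    have "\<eta> > 0" using that by (simp add: \<eta>_def)
    obtain w where w: "w \<in> W" "dist w z < \<eta>"
      using \<open>z \<in> closure W\<close> \<open>\<eta> > 0\<close> unfolding closure_approachable by blast
    obtain r i where r: "r > 0" "r *\<^sub>R w \<in> ball_sums S i"
      using span_ranges_ball_sums w(1) unfolding W_def by blast
    obtain k where "norm (r *\<^sub>R w) - r * \<eta> \<le> blinfun_apply (e i k) (r *\<^sub>R w)"
      using e[OF r(2), of "r * \<eta>"] r(1) \<open>\<eta> > 0\<close> by auto
    then have "r * (norm w - \<eta>) \<le> r * blinfun_apply (e i k) w"
      using r(1) by (simp add: blinfun.scaleR_right algebra_simps)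
    then have "norm w - \<eta> \<le> blinfun_apply (e i k) w" using r(1) by simp
    also have "\<dots> = blinfun_apply (e i k) (w - z)"
      using z(1)[of "e i k"] null[of i k] by (simp add: Y_def blinfun.diff_right)
    also have "\<dots> \<le> norm (e i k) * norm (w - z)" using norm_blinfun[of "e i k" "w - z"] by simp
    also have "\<dots> \<le> 1 * norm (w - z)" by (intro mult_right_mono e_norm) auto
    finally have "norm w \<le> 2 * \<eta>" using w(2) by (simp add: dist_norm)
    moreover have "norm z \<le> norm w + norm (w - z)"
      using norm_triangle_sub[of z w] by (simp add: norm_minus_commute)
    ultimately show ?thesis using w(2) by (simp add: dist_norm \<eta>_def)
  qed
  then have "norm z \<le> 0" by (rule field_le_epsilon)
  then show False using z(2) by (simp add: blinfun.zero_right)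
qed

text \<open>
  A net-to-sequence reduction. At stage \<open>n\<close> an operator \<open>S\<^sub>n \<in> A\<close> is chosen for which \<open>\<parallel>e \<circ> S\<^sub>n\<parallel>\<close> is small
  for the first few functionals \<open>e\<close> norming the ranges of \<open>S\<^sub>0, \<dots>, S\<^sub>n\<^sub>-\<^sub>1\<close> and their sums. The
  resulting sequence tends to \<open>0\<close> under every \<open>\<Psi> \<otimes> f\<close>, and Simons' inequality applies to it.\<close>

theorem zero_adherent_imp_norm_adherent:
  fixes A :: "('x::real_normed_vector \<Rightarrow>\<^sub>L 'z::banach) set"
  assumes refl: "reflexive_space TYPE('z)"
    and cpt: "\<And>T :: 'x \<Rightarrow>\<^sub>L 'z. compact_operator T"
    and "convex A" and bound: "\<And>T. T \<in> A \<Longrightarrow> norm T \<le> M"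
    and "zero_adherent A" and "\<epsilon> > 0"
  obtains T where "T \<in> A" "norm T < \<epsilon>"
proof -
  define norms where "norms e P \<longleftrightarrow> (\<forall>k. norm (e k) \<le> 1) \<and>
    (\<forall>z\<in>P. \<forall>\<eta>>0. \<exists>k. norm z - \<eta> \<le> blinfun_apply (e k) z)" for e :: "nat \<Rightarrow> 'z \<Rightarrow>\<^sub>L real" and P
  \<comment> \<open>a function of the set, so that the choice at stage \<open>n\<close> depends on the operators before \<open>n\<close> only\<close>
  define E where "E P = (SOME e. norms e P)" for P
  have E: "norms (E (ball_sums S n)) (ball_sums S n)" for S :: "nat \<Rightarrow> 'x \<Rightarrow>\<^sub>L 'z" and n
  proof -
    obtain K where K: "compact K" "ball_sums S n \<subseteq> K" using ball_sums_in_compact[OF cpt] .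
    obtain e where "norms e K"
      using compact_set_normed_by_sequence[OF K(1)] unfolding norms_def by metis
    then have "norms e (ball_sums S n)" using K(2) by (auto simp: norms_def)
    then show ?thesis unfolding E_def by (rule someI[of "\<lambda>e. norms e (ball_sums S n)"])
  qed
  let ?P = "\<lambda>S n T. T \<in> A \<and>
    (\<forall>i\<le>n. \<forall>k\<le>n. norm (E (ball_sums S i) k o\<^sub>L T) < 1 / real (Suc n))"
  have "\<exists>S. \<forall>n. ?P S n (S n)"
  proof (rule dependent_wf_choice[OF wf_less])
    fix S S' :: "nat \<Rightarrow> 'x \<Rightarrow>\<^sub>L 'z" and n T
    assume "\<And>m. (m, n) \<in> {(x, y). x < y} \<Longrightarrow> S m = S' m"
    then have "ball_sums S i = ball_sums S' i" if "i \<le> n" for i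
      using that by (intro ball_sums_cong) auto
    then show "?P S n T = ?P S' n T" by simp
  next
    fix S :: "nat \<Rightarrow> 'x \<Rightarrow>\<^sub>L 'z" and n
    have "finite ((\<lambda>(i, k). E (ball_sums S i) k) ` ({..n} \<times> {..n}))" by simp
    then obtain T where "T \<in> A" and
      "\<And>f. f \<in> (\<lambda>(i, k). E (ball_sums S i) k) ` ({..n} \<times> {..n}) \<Longrightarrow> norm (f o\<^sub>L T) < 1 / real (Suc n)"
      using zero_adherent_small_compositions[OF \<open>convex A\<close> \<open>zero_adherent A\<close>, of "1 / real (Suc n)"]
      by (metis of_nat_0_less_iff zero_less_Suc zero_less_divide_1_iff)
    then show "\<exists>T. ?P S n T" by (intro exI[of _ T]) force
  qed
  then obtain S where S: "\<And>n. S n \<in> A"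
    and small: "\<And>n i k. i \<le> n \<Longrightarrow> k \<le> n \<Longrightarrow> norm (E (ball_sums S i) k o\<^sub>L S n) < 1 / real (Suc n)"
    by blast
  have null: "(\<lambda>n. f o\<^sub>L S n) \<longlonglongrightarrow> 0" for f :: "'z \<Rightarrow>\<^sub>L real"
  proof (rule null_on_norming_imp_null[OF refl, where e = "\<lambda>i. E (ball_sums S i)"])
    show "norm (S n) \<le> M" for n using bound S by blast
    show "norm (E (ball_sums S i) k) \<le> 1" for i k using E[of S i] by (simp add: norms_def)
    show "\<exists>k. norm z - \<eta> \<le> blinfun_apply (E (ball_sums S i) k) z"
      if "z \<in> ball_sums S i" "\<eta> > 0" for i z \<eta> using E[of S i] that by (simp add: norms_def)
    show "(\<lambda>n. E (ball_sums S i) k o\<^sub>L S n) \<longlonglongrightarrow> 0" for i k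
    proof (rule Lim_null_comparison)
      show "(\<lambda>n. 1 / real (Suc n)) \<longlonglongrightarrow> 0"
        using LIMSEQ_inverse_real_of_nat by (simp add: inverse_eq_divide)
      show "\<forall>\<^sub>F n in sequentially. norm (E (ball_sums S i) k o\<^sub>L S n) \<le> 1 / real (Suc n)"
        using eventually_ge_at_top[of "max i k"] by eventually_elim (rule less_imp_le[OF small], auto)
    qed
  qed
  define L where "L = {bidual_tensor \<Psi> f | (\<Psi> :: ('x \<Rightarrow>\<^sub>L real) \<Rightarrow>\<^sub>L real) (f :: 'z \<Rightarrow>\<^sub>L real).
    norm \<Psi> \<le> 1 \<and> norm f \<le> 1}"
  have "\<exists>T\<in>convex hull range S. norm T < \<epsilon>"
  proof (rule small_convex_combination[of S M L])
    show "norm (S n) \<le> M" for n using bound S by blast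
    show "norm l \<le> 1" if l_in: "l \<in> L" for l
    proof -
      obtain \<Psi> :: "('x \<Rightarrow>\<^sub>L real) \<Rightarrow>\<^sub>L real" and f :: "'z \<Rightarrow>\<^sub>L real"
        where l: "l = bidual_tensor \<Psi> f" "norm \<Psi> \<le> 1" "norm f \<le> 1"
        using l_in unfolding L_def by blast
      have "norm \<Psi> * norm f \<le> 1 * 1" using l by (intro mult_mono) auto
      then show ?thesis using norm_bidual_tensor_le[of \<Psi> f] l(1) by simp
    qed
    show "\<exists>l\<in>L. blinfun_apply l U = norm U" for U
    proof -
      obtain \<Psi> :: "('x \<Rightarrow>\<^sub>L real) \<Rightarrow>\<^sub>L real" and f :: "'z \<Rightarrow>\<^sub>L real"
        where "norm \<Psi> \<le> 1" "norm f \<le> 1" "blinfun_apply \<Psi> (f o\<^sub>L U) = norm U"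
        using compact_operator_attains_norm[OF cpt] .
      then show ?thesis
        by (intro bexI[of _ "bidual_tensor \<Psi> f"]) (auto simp: L_def bidual_tensor.rep_eq)
    qed
    show "(\<lambda>n. blinfun_apply l (S n)) \<longlonglongrightarrow> 0" if l_in: "l \<in> L" for l
    proof -
      obtain \<Psi> :: "('x \<Rightarrow>\<^sub>L real) \<Rightarrow>\<^sub>L real" and f :: "'z \<Rightarrow>\<^sub>L real"
        where "l = bidual_tensor \<Psi> f" using l_in unfolding L_def by blast
      then show ?thesis
        using blinfun.tendsto[OF tendsto_const null[of f], of \<Psi>]
        by (simp add: bidual_tensor.rep_eq blinfun.zero_right)
    qed
  qed (fact \<open>\<epsilon> > 0\<close>)
  moreover have "convex hull range S \<subseteq> A"
    using S by (intro hull_minimal \<open>convex A\<close>) auto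
  ultimately show thesis using that by blast
qed

section \<open>Weak topologies and rank-one operators\<close>

lemma topspace_initial_topology: "\<Phi> \<noteq> {} \<Longrightarrow> topspace (initial_topology \<Phi>) = UNIV"
  unfolding initial_topology_def topology_generated_by_topspace by (auto intro!: exI[of _ UNIV])

lemma openin_initial_topology: "\<phi> \<in> \<Phi> \<Longrightarrow> open U \<Longrightarrow> openin (initial_topology \<Phi>) (\<phi> -` U)"
  unfolding initial_topology_def by (rule topology_generated_by_Basis) blast

lemma continuous_map_initial_topology:
  assumes "\<Phi> \<noteq> {}" and "\<And>\<phi> U. \<phi> \<in> \<Phi> \<Longrightarrow> open U \<Longrightarrow> openin X {x \<in> topspace X. \<phi> (h x) \<in> U}"
  shows "continuous_map X (initial_topology \<Phi>) h"
  unfolding initial_topology_def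
proof (rule continuous_on_generated_topo)
  fix V assume "V \<in> {\<phi> -` U | \<phi> U. \<phi> \<in> \<Phi> \<and> open U}"
  then obtain \<phi> U where "V = \<phi> -` U" "\<phi> \<in> \<Phi>" "open U" by blast
  moreover have "h -` (\<phi> -` U) \<inter> topspace X = {x \<in> topspace X. \<phi> (h x) \<in> U}" by auto
  ultimately show "openin X (h -` V \<inter> topspace X)" using assms(2) by simp
next
  show "h ` topspace X \<subseteq> \<Union> {\<phi> -` U | \<phi> U. \<phi> \<in> \<Phi> \<and> open U}"
    using topspace_initial_topology[OF assms(1)]
    unfolding initial_topology_def topology_generated_by_topspace by simp
qed

text \<open>
  Continuity at a point into an initial topology can be tested on the generating functions. Only points of
  \<open>B\<close> are controlled, which accounts for subspace topologies.\<close>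

lemma generate_topology_on_nhds:
  fixes \<Phi> :: "('a \<Rightarrow> real) set"
  assumes "generate_topology_on {\<phi> -` U | \<phi> U. \<phi> \<in> \<Phi> \<and> open U} V" "z \<in> V" "openin W UNIV"
    and nhds: "\<And>\<phi> \<epsilon>. \<phi> \<in> \<Phi> \<Longrightarrow> \<epsilon> > 0 \<Longrightarrow>
      \<exists>U. openin W U \<and> z \<in> U \<and> (\<forall>w\<in>U \<inter> B. \<bar>\<phi> w - \<phi> z\<bar> < \<epsilon>)"
  shows "\<exists>U. openin W U \<and> z \<in> U \<and> U \<inter> B \<subseteq> V"
  using assms(1,2)
proof induction
  case (Int a b)
  then obtain U U' where "openin W U \<and> z \<in> U \<and> U \<inter> B \<subseteq> a" "openin W U' \<and> z \<in> U' \<and> U' \<inter> B \<subseteq> b"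
    by blast
  then show ?case by (intro exI[of _ "U \<inter> U'"]) auto
next
  case (UN K)
  then obtain k where "k \<in> K" "z \<in> k" by blast
  then show ?case using UN.IH[of k] by blast
next
  case (Basis s)
  then obtain \<phi> U where s: "s = \<phi> -` U" "\<phi> \<in> \<Phi>" "open U" by blast
  then obtain \<epsilon> where "\<epsilon> > 0" "\<And>r. dist r (\<phi> z) < \<epsilon> \<Longrightarrow> r \<in> U"
    using Basis(2) unfolding open_dist by auto
  then show ?case using nhds[OF s(2), of \<epsilon>] s(1) by (auto simp: dist_real_def)
qed auto

text \<open>The neighbourhood form of the Namioka property, one functional of the dual at a time.\<close>

lemma namioka_point_iff:
  fixes z :: "'a::real_normed_vector"
  assumes W: "topspace W = UNIV"
  shows "namioka_point W z \<longleftrightarrow> norm z \<le> 1 \<and>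
    (\<forall>\<phi> :: 'a \<Rightarrow>\<^sub>L real. \<forall>\<epsilon>>0. \<exists>U. openin W U \<and> z \<in> U \<and>
      (\<forall>w\<in>U. norm w \<le> 1 \<longrightarrow> \<bar>blinfun_apply \<phi> w - blinfun_apply \<phi> z\<bar> < \<epsilon>))"
    (is "_ \<longleftrightarrow> _ \<and> ?nhds")
proof
  have top: "topspace (weak_topology :: 'a topology) = UNIV"
    unfolding weak_topology_def by (rule topspace_initial_topology) simp
  {
    assume "namioka_point W z"
    then have N: "z \<in> topspace (subtopology W (cball 0 1))"
      "\<forall>V. openin (subtopology weak_topology (cball 0 1)) V \<and> z \<in> V \<longrightarrow>
        (\<exists>U. openin (subtopology W (cball 0 1)) U \<and> z \<in> U \<and> (\<forall>y\<in>U. y \<in> V))"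
      unfolding namioka_point_def topcontinuous_at_def by blast+
    from N(1) have z: "norm z \<le> 1" by simp
    have ?nhds
    proof (intro allI impI)
      fix \<phi> :: "'a \<Rightarrow>\<^sub>L real" and \<epsilon> :: real assume "\<epsilon> > 0"
      define V where "V = blinfun_apply \<phi> -` ball (blinfun_apply \<phi> z) \<epsilon>"
      have "openin weak_topology V"
        unfolding weak_topology_def V_def by (rule openin_initial_topology) auto
      then have "openin (subtopology weak_topology (cball 0 1)) (V \<inter> cball 0 1)"
        by (auto simp: openin_subtopology)
      moreover have "z \<in> V \<inter> cball 0 1" using z \<open>\<epsilon> > 0\<close> by (simp add: V_def)
      ultimately obtain U where U: "openin (subtopology W (cball 0 1)) U" "z \<in> U" "\<forall>y\<in>U. y \<in> V \<inter> cball 0 1"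
        using N(2)[rule_format, of "V \<inter> cball 0 1"] by blast
      then obtain U' where "openin W U'" "U = U' \<inter> cball 0 1" by (auto simp: openin_subtopology)
      then show "\<exists>U. openin W U \<and> z \<in> U \<and>
          (\<forall>w\<in>U. norm w \<le> 1 \<longrightarrow> \<bar>blinfun_apply \<phi> w - blinfun_apply \<phi> z\<bar> < \<epsilon>)"
        using U by (intro exI[of _ U']) (auto simp: V_def dist_real_def abs_minus_commute)
    qed
    with z show "norm z \<le> 1 \<and> ?nhds" by blast
  next
    assume "norm z \<le> 1 \<and> ?nhds"
    then have z: "norm z \<le> 1" and nhds: ?nhds by blast+
    show "namioka_point W z"
      unfolding namioka_point_def topcontinuous_at_def
    proof (intro conjI allI impI)
      show "z \<in> topspace (subtopology W (cball 0 1))" using z W by simp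
      show "(\<lambda>z. z) \<in> topspace (subtopology W (cball 0 1)) \<rightarrow> topspace (subtopology weak_topology (cball 0 1))"
        using W top by simp
      fix V assume V: "openin (subtopology weak_topology (cball 0 1)) V \<and> z \<in> V"
      then obtain V' where V': "openin weak_topology V'" "V = V' \<inter> cball 0 1"
        by (auto simp: openin_subtopology)
      have "\<exists>U. openin W U \<and> z \<in> U \<and> U \<inter> cball 0 1 \<subseteq> V'"
      proof (rule generate_topology_on_nhds)
        show "generate_topology_on {\<phi> -` U | \<phi> U. \<phi> \<in> range (blinfun_apply :: ('a \<Rightarrow>\<^sub>L real) \<Rightarrow> 'a \<Rightarrow> real) \<and> open U} V'"
          using V'(1) unfolding weak_topology_def initial_topology_def
          by (rule openin_topology_generated_by)
        show "z \<in> V'" using V V' by blast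
        show "openin W UNIV" using W openin_topspace[of W] by simp
        show "\<exists>U. openin W U \<and> z \<in> U \<and> (\<forall>w\<in>U \<inter> cball 0 1. \<bar>\<phi> w - \<phi> z\<bar> < \<epsilon>)"
          if "\<phi> \<in> range (blinfun_apply :: ('a \<Rightarrow>\<^sub>L real) \<Rightarrow> 'a \<Rightarrow> real)" "\<epsilon> > 0" for \<phi> \<epsilon>
          using that nhds by fastforce
      qed
      then obtain U where "openin W U" "z \<in> U" "U \<inter> cball 0 1 \<subseteq> V'" by blast
      then show "\<exists>U. openin (subtopology W (cball 0 1)) U \<and> z \<in> U \<and> (\<forall>y\<in>U. y \<in> V)"
        using z V' by (intro exI[of _ "U \<inter> cball 0 1"]) (auto simp: openin_subtopology)
    qed
  }
qed

lemma topspace_weak_star_topology: "topspace weak_star_topology = UNIV"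
  unfolding weak_star_topology_def by (rule topspace_initial_topology) simp

lemma topspace_operator_weak_star_topology: "topspace operator_weak_star_topology = UNIV"
  by (simp add: operator_weak_star_topology_def topspace_pullback_topology topspace_weak_star_topology)

text \<open>
  The value at \<open>x\<close> of the composition of \<open>T\<close> with evaluation at \<open>y\<close> is the pairing of \<open>T\<close> with the
  elementary tensor \<open>x \<otimes> y\<close> of the predual.\<close>

lemma continuous_map_compose_evaluation:
  "continuous_map operator_weak_star_topology weak_star_topology
     (\<lambda>T :: 'x::real_normed_vector \<Rightarrow>\<^sub>L 'y::real_normed_vector \<Rightarrow>\<^sub>L real. bidual_embedding y o\<^sub>L T)"
  unfolding weak_star_topology_def
proof (rule continuous_map_initial_topology)
  fix \<phi> :: "('x \<Rightarrow>\<^sub>L real) \<Rightarrow> real" and U :: "real set"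
  assume "\<phi> \<in> range (\<lambda>(x :: 'x) f. blinfun_apply f x)" and U: "open U"
  then obtain x :: 'x where \<phi>: "\<phi> = (\<lambda>f. blinfun_apply f x)" by blast
  define V where "V = (\<lambda>F :: ('x, 'y) proj_tensor \<Rightarrow>\<^sub>L real. blinfun_apply F (proj_elem x y)) -` U"
  have "openin weak_star_topology V"
    unfolding weak_star_topology_def V_def by (rule openin_initial_topology) (use U in auto)
  then have "openin operator_weak_star_topology (operator_functional -` V \<inter> UNIV)"
    unfolding operator_weak_star_topology_def openin_pullback_topology by blast
  moreover have "operator_functional -` V \<inter> UNIV
      = {T \<in> topspace operator_weak_star_topology. \<phi> (bidual_embedding y o\<^sub>L T) \<in> U}"
    by (auto simp: V_def \<phi> topspace_operator_weak_star_topology bidual_embedding_apply)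
  ultimately show "openin operator_weak_star_topology
      {T \<in> topspace operator_weak_star_topology. \<phi> (bidual_embedding y o\<^sub>L T) \<in> U}"
    by simp
qed simp

lemma rank_one_apply: "blinfun_apply (rank_one f z) x = blinfun_apply f x *\<^sub>R z"
  by transfer simp

lemma norm_rank_one: "norm (rank_one f z) = norm f * norm z"
proof (rule antisym)
  show "norm (rank_one f z) \<le> norm f * norm z"
  proof (rule norm_blinfun_bound)
    fix x
    have "norm (blinfun_apply f x) * norm z \<le> norm f * norm x * norm z"
      by (intro mult_right_mono norm_blinfun) auto
    then show "norm (blinfun_apply (rank_one f z) x) \<le> norm f * norm z * norm x"
      by (simp add: rank_one_apply mult_ac)
  qed simp
  show "norm f * norm z \<le> norm (rank_one f z)"
  proof (cases "z = 0")
    case False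
    have "norm f \<le> norm (rank_one f z) / norm z"
    proof (rule norm_blinfun_bound)
      fix x
      show "norm (blinfun_apply f x) \<le> norm (rank_one f z) / norm z * norm x"
        using norm_blinfun[of "rank_one f z" x] False by (simp add: rank_one_apply field_simps)
    qed simp
    then show ?thesis using False by (simp add: field_simps)
  qed simp
qed

lemma compose_rank_one: "f o\<^sub>L rank_one g z = blinfun_apply f z *\<^sub>R g"
  by (rule blinfun_eqI) (simp add: rank_one_apply blinfun.scaleR_right scaleR_blinfun.rep_eq)

section \<open>Namioka points of spaces of compact operators\<close>

text \<open>
  In order to verify the Namioka property of an operator, it is enough to treat the functionals
  \<open>\<Psi> \<otimes> f\<close>. If every neighbourhood of \<open>T\<^sub>0\<close> contained points of the ball at which another functional \<open>\<phi>\<close>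
  is at least \<open>\<phi>(T\<^sub>0) + \<epsilon>\<close>, all such points of the ball would form a convex set with \<open>T\<^sub>0\<close> in its closure for the functionals
  \<open>\<Psi> \<otimes> f\<close>, hence in its norm closure, contrary to the continuity of \<open>\<phi>\<close>.\<close>

lemma namioka_pointI_compact_operators:
  fixes T0 :: "'x::real_normed_vector \<Rightarrow>\<^sub>L 'z::banach"
  assumes W: "topspace W = UNIV" and T0: "norm T0 \<le> 1"
    and refl: "reflexive_space TYPE('z)"
    and cpt: "\<And>T :: 'x \<Rightarrow>\<^sub>L 'z. compact_operator T"
    and nhds: "\<And>(\<Psi> :: ('x \<Rightarrow>\<^sub>L real) \<Rightarrow>\<^sub>L real) (f :: 'z \<Rightarrow>\<^sub>L real) \<delta>. \<delta> > 0 \<Longrightarrow>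
      \<exists>U. openin W U \<and> T0 \<in> U \<and>
        (\<forall>T\<in>U. norm T \<le> 1 \<longrightarrow> \<bar>blinfun_apply \<Psi> (f o\<^sub>L T) - blinfun_apply \<Psi> (f o\<^sub>L T0)\<bar> < \<delta>)"
  shows "namioka_point W T0"
proof -
  have fin: "\<exists>U. openin W U \<and> T0 \<in> U \<and>
      (\<forall>T\<in>U. norm T \<le> 1 \<longrightarrow> (\<forall>(\<Psi>, f)\<in>Q. \<bar>blinfun_apply \<Psi> (f o\<^sub>L (T - T0))\<bar> < \<delta>))"
    if "finite Q" "\<delta> > 0" for Q :: "((('x \<Rightarrow>\<^sub>L real) \<Rightarrow>\<^sub>L real) \<times> ('z \<Rightarrow>\<^sub>L real)) set" and \<delta>
    using \<open>finite Q\<close>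
  proof (induction Q)
    case empty
    have "openin W UNIV" using openin_topspace[of W] W by simp
    then show ?case by auto
  next
    case (insert q Q)
    obtain \<Psi> f where q: "q = (\<Psi>, f)" by (cases q)
    obtain U where U: "openin W U" "T0 \<in> U"
      "\<And>T. T \<in> U \<Longrightarrow> norm T \<le> 1 \<Longrightarrow> (\<forall>(\<Psi>, f)\<in>Q. \<bar>blinfun_apply \<Psi> (f o\<^sub>L (T - T0))\<bar> < \<delta>)"
      using insert.IH by blast
    obtain V where V: "openin W V" "T0 \<in> V"
      "\<And>T. T \<in> V \<Longrightarrow> norm T \<le> 1 \<Longrightarrow> \<bar>blinfun_apply \<Psi> (f o\<^sub>L T) - blinfun_apply \<Psi> (f o\<^sub>L T0)\<bar> < \<delta>"
      using nhds[OF \<open>\<delta> > 0\<close>, of \<Psi> f] by blast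
    have "blinfun_apply \<Psi> (f o\<^sub>L (T - T0)) = blinfun_apply \<Psi> (f o\<^sub>L T) - blinfun_apply \<Psi> (f o\<^sub>L T0)" for T
      by (simp add: bounded_bilinear.diff_right[OF bounded_bilinear_blinfun_compose] blinfun.diff_right)
    then show ?case
      using U V by (intro exI[of _ "U \<inter> V"]) (auto simp: q)
  qed
  have above: "\<exists>U. openin W U \<and> T0 \<in> U \<and>
      (\<forall>T\<in>U. norm T \<le> 1 \<longrightarrow> blinfun_apply \<phi> T < blinfun_apply \<phi> T0 + \<epsilon>)"
    if "\<epsilon> > 0" for \<phi> :: "('x \<Rightarrow>\<^sub>L 'z) \<Rightarrow>\<^sub>L real" and \<epsilon>
  proof (rule ccontr)
    assume no: "\<not> ?thesis"
    define A where "A = {S. norm (S + T0) \<le> 1 \<and> \<epsilon> \<le> blinfun_apply \<phi> S}"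
    have "convex A"
    proof (rule convexI)
      fix S S' and u v :: real assume *: "S \<in> A" "S' \<in> A" "u \<ge> 0" "v \<ge> 0" "u + v = 1"
      have "u *\<^sub>R S + v *\<^sub>R S' + T0 = u *\<^sub>R (S + T0) + v *\<^sub>R (S' + T0)"
        using *(5) by (simp add: scaleR_add_right algebra_simps flip: scaleR_add_left)
      also have "norm \<dots> \<le> u * norm (S + T0) + v * norm (S' + T0)"
        using norm_triangle_ineq[of "u *\<^sub>R (S + T0)" "v *\<^sub>R (S' + T0)"] * by simp
      also have "\<dots> \<le> 1" using * by (intro convex_bound_le) (auto simp: A_def)
      finally have "norm (u *\<^sub>R S + v *\<^sub>R S' + T0) \<le> 1" .
      moreover have "u * (- blinfun_apply \<phi> S) + v * (- blinfun_apply \<phi> S') \<le> - \<epsilon>"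
        using * by (intro convex_bound_le) (auto simp: A_def)
      ultimately show "u *\<^sub>R S + v *\<^sub>R S' \<in> A" by (simp add: A_def blinfun.bilinear_simps)
    qed
    have bound: "norm S \<le> 2" if "S \<in> A" for S
      using that T0 norm_triangle_ineq4[of "S + T0" T0] by (simp add: A_def)
    have "zero_adherent A"
      unfolding zero_adherent_def
    proof (intro allI impI)
      fix Q :: "((('x \<Rightarrow>\<^sub>L real) \<Rightarrow>\<^sub>L real) \<times> ('z \<Rightarrow>\<^sub>L real)) set" and \<delta> :: real
      assume "\<delta> > 0" "finite Q"
      obtain U where U: "openin W U" "T0 \<in> U"
        "\<And>T. T \<in> U \<Longrightarrow> norm T \<le> 1 \<Longrightarrow> (\<forall>(\<Psi>, f)\<in>Q. \<bar>blinfun_apply \<Psi> (f o\<^sub>L (T - T0))\<bar> < \<delta>)"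
        using fin[OF \<open>finite Q\<close> \<open>\<delta> > 0\<close>] by blast
      obtain T where T: "T \<in> U" "norm T \<le> 1" "blinfun_apply \<phi> T0 + \<epsilon> \<le> blinfun_apply \<phi> T"
        using no U(1,2) by (metis not_less)
      then have "T - T0 \<in> A" by (simp add: A_def blinfun.diff_right)
      then show "\<exists>S\<in>A. \<forall>(\<Psi>, f)\<in>Q. \<bar>blinfun_apply \<Psi> (f o\<^sub>L S)\<bar> < \<delta>"
        using U(3)[OF T(1,2)] by (intro bexI[of _ "T - T0"])
    qed
    moreover have "\<epsilon> / (norm \<phi> + 1) > 0" using \<open>\<epsilon> > 0\<close> by (simp add: add_nonneg_pos)
    ultimately obtain S where S: "S \<in> A" "norm S < \<epsilon> / (norm \<phi> + 1)"
      using zero_adherent_imp_norm_adherent[OF refl cpt \<open>convex A\<close> bound] by metis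
    have "blinfun_apply \<phi> S \<le> norm \<phi> * norm S" using norm_blinfun[of \<phi> S] by simp
    also have "\<dots> \<le> (norm \<phi> + 1) * norm S" by (intro mult_right_mono) auto
    also have "\<dots> < \<epsilon>" using S(2) by (simp add: pos_less_divide_eq add_nonneg_pos mult.commute)
    finally show False using S(1) by (simp add: A_def)
  qed
  show ?thesis
    unfolding namioka_point_iff[OF W]
  proof (intro conjI allI impI)
    fix \<phi> :: "('x \<Rightarrow>\<^sub>L 'z) \<Rightarrow>\<^sub>L real" and \<epsilon> :: real assume "\<epsilon> > 0"
    obtain U where U: "openin W U" "T0 \<in> U"
      "\<And>T. T \<in> U \<Longrightarrow> norm T \<le> 1 \<Longrightarrow> blinfun_apply \<phi> T < blinfun_apply \<phi> T0 + \<epsilon>"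
      using above[OF \<open>\<epsilon> > 0\<close>, of \<phi>] by metis
    obtain V where V: "openin W V" "T0 \<in> V"
      "\<And>T. T \<in> V \<Longrightarrow> norm T \<le> 1 \<Longrightarrow> blinfun_apply (- \<phi>) T < blinfun_apply (- \<phi>) T0 + \<epsilon>"
      using above[OF \<open>\<epsilon> > 0\<close>, of "- \<phi>"] by metis
    show "\<exists>U. openin W U \<and> T0 \<in> U \<and>
        (\<forall>T\<in>U. norm T \<le> 1 \<longrightarrow> \<bar>blinfun_apply \<phi> T - blinfun_apply \<phi> T0\<bar> < \<epsilon>)"
    proof (intro exI[of _ "U \<inter> V"] conjI ballI impI)
      fix T assume "T \<in> U \<inter> V" "norm T \<le> 1"
      then have "blinfun_apply \<phi> T < blinfun_apply \<phi> T0 + \<epsilon>"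
        "- blinfun_apply \<phi> T < - blinfun_apply \<phi> T0 + \<epsilon>"
        using U(3)[of T] V(3)[of T] by (auto simp: blinfun.minus_left)
      then show "\<bar>blinfun_apply \<phi> T - blinfun_apply \<phi> T0\<bar> < \<epsilon>" by (simp add: abs_less_iff)
    qed (use U V in auto)
  qed (fact T0)
qed

text \<open>
  The functionals \<open>f\<close> that satisfy the claim form a subspace, so by unitarity only \<open>f\<close> with
  \<open>\<parallel>f\<parallel> \<le> 1 = f(y\<^sub>0)\<close> matter. For these, \<open>T \<mapsto> f \<circ> T\<close> is a weak-star continuous map between the
  unit balls that sends \<open>rank_one x\<^sub>0 y\<^sub>0\<close> to the Namioka point \<open>x\<^sub>0\<close>.\<close>

lemma rank_one_unitary_nhds:
  fixes x0 :: "'x::real_normed_vector \<Rightarrow>\<^sub>L real" and y0 :: "'y::real_normed_vector \<Rightarrow>\<^sub>L real"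
    and \<Psi> :: "('x \<Rightarrow>\<^sub>L real) \<Rightarrow>\<^sub>L real" and f :: "('y \<Rightarrow>\<^sub>L real) \<Rightarrow>\<^sub>L real"
  assumes refl: "reflexive_space TYPE('y)" and "unitary y0"
    and x0: "namioka_point weak_star_topology x0" and "\<epsilon> > 0"
  shows "\<exists>U. openin operator_weak_star_topology U \<and> rank_one x0 y0 \<in> U \<and>
    (\<forall>T\<in>U. norm T \<le> 1 \<longrightarrow>
      \<bar>blinfun_apply \<Psi> (f o\<^sub>L T) - blinfun_apply \<Psi> (f o\<^sub>L rank_one x0 y0)\<bar> < \<epsilon>)"
proof -
  let ?T0 = "rank_one x0 y0"
  define near where "near f \<epsilon> U \<longleftrightarrow> openin operator_weak_star_topology U \<and> ?T0 \<in> U \<and>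
    (\<forall>T\<in>U. norm T \<le> 1 \<longrightarrow> \<bar>blinfun_apply \<Psi> (f o\<^sub>L T) - blinfun_apply \<Psi> (f o\<^sub>L ?T0)\<bar> < \<epsilon>)"
    for f :: "('y \<Rightarrow>\<^sub>L real) \<Rightarrow>\<^sub>L real" and \<epsilon> U
  have nearI: "near f \<epsilon> U" if "openin operator_weak_star_topology U" "?T0 \<in> U"
    "\<And>T. T \<in> U \<Longrightarrow> norm T \<le> 1 \<Longrightarrow> \<bar>blinfun_apply \<Psi> (f o\<^sub>L T) - blinfun_apply \<Psi> (f o\<^sub>L ?T0)\<bar> < \<epsilon>"
    for f \<epsilon> U using that by (simp add: near_def)
  have nearD: "openin operator_weak_star_topology U" "?T0 \<in> U"
    "\<And>T. T \<in> U \<Longrightarrow> norm T \<le> 1 \<Longrightarrow> \<bar>blinfun_apply \<Psi> (f o\<^sub>L T) - blinfun_apply \<Psi> (f o\<^sub>L ?T0)\<bar> < \<epsilon>"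
    if "near f \<epsilon> U" for f \<epsilon> U using that by (simp_all add: near_def)
  note comp = bounded_bilinear_blinfun_compose
  \<comment> \<open>quantified over all \<open>\<epsilon>\<close> because sums and multiples change it\<close>
  define G where "G = {f. \<forall>\<epsilon>>0. \<exists>U. near f \<epsilon> U}"
  have "subspace G"
  proof (rule subspaceI)
    have "openin operator_weak_star_topology (UNIV :: ('x \<Rightarrow>\<^sub>L 'y \<Rightarrow>\<^sub>L real) set)"
      using openin_topspace[of operator_weak_star_topology]
      by (simp add: topspace_operator_weak_star_topology)
    then have "near 0 \<epsilon> UNIV" if "\<epsilon> > 0" for \<epsilon>
      using that by (simp add: near_def bounded_bilinear.zero_left[OF comp] blinfun.zero_right)
    then show "0 \<in> G" unfolding G_def by blast
    show "f + g \<in> G" if fg: "f \<in> G" "g \<in> G" for f g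
      unfolding G_def
    proof (intro CollectI allI impI)
      fix \<epsilon> :: real assume "\<epsilon> > 0"
      then have "\<epsilon> / 2 > 0" by simp
      obtain U where U: "near f (\<epsilon> / 2) U" using fg(1) \<open>\<epsilon> / 2 > 0\<close> unfolding G_def by blast
      obtain V where V: "near g (\<epsilon> / 2) V" using fg(2) \<open>\<epsilon> / 2 > 0\<close> unfolding G_def by blast
      have "near (f + g) \<epsilon> (U \<inter> V)"
      proof (rule nearI)
        fix T :: "'x \<Rightarrow>\<^sub>L 'y \<Rightarrow>\<^sub>L real" assume "T \<in> U \<inter> V" "norm T \<le> 1"
        then have "\<bar>blinfun_apply \<Psi> (f o\<^sub>L T) - blinfun_apply \<Psi> (f o\<^sub>L ?T0)\<bar> < \<epsilon> / 2"
          "\<bar>blinfun_apply \<Psi> (g o\<^sub>L T) - blinfun_apply \<Psi> (g o\<^sub>L ?T0)\<bar> < \<epsilon> / 2"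
          using nearD(3)[OF U, of T] nearD(3)[OF V, of T] by auto
        moreover have eq: "blinfun_apply \<Psi> ((f + g) o\<^sub>L R)
            = blinfun_apply \<Psi> (f o\<^sub>L R) + blinfun_apply \<Psi> (g o\<^sub>L R)" for R :: "'x \<Rightarrow>\<^sub>L 'y \<Rightarrow>\<^sub>L real"
          by (simp add: bounded_bilinear.add_left[OF comp] blinfun.add_right)
        ultimately show "\<bar>blinfun_apply \<Psi> ((f + g) o\<^sub>L T) - blinfun_apply \<Psi> ((f + g) o\<^sub>L ?T0)\<bar> < \<epsilon>"
          unfolding eq by linarith
      qed (use nearD(1,2)[OF U] nearD(1,2)[OF V] in auto)
      then show "\<exists>U. near (f + g) \<epsilon> U" by blast
    qed
    show "c *\<^sub>R f \<in> G" if f: "f \<in> G" for c f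
      unfolding G_def
    proof (intro CollectI allI impI)
      fix \<epsilon> :: real assume "\<epsilon> > 0"
      then have "\<epsilon> / (\<bar>c\<bar> + 1) > 0" by (simp add: add_nonneg_pos)
      then obtain U where U: "near f (\<epsilon> / (\<bar>c\<bar> + 1)) U" using f unfolding G_def by blast
      have "near (c *\<^sub>R f) \<epsilon> U"
      proof (rule nearI)
        fix T :: "'x \<Rightarrow>\<^sub>L 'y \<Rightarrow>\<^sub>L real" assume T: "T \<in> U" "norm T \<le> 1"
        let ?d = "blinfun_apply \<Psi> (f o\<^sub>L T) - blinfun_apply \<Psi> (f o\<^sub>L ?T0)"
        have "\<bar>?d\<bar> * (\<bar>c\<bar> + 1) < \<epsilon>"
          using nearD(3)[OF U T] by (simp add: pos_less_divide_eq add_nonneg_pos)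
        moreover have "\<bar>c * ?d\<bar> \<le> \<bar>?d\<bar> * (\<bar>c\<bar> + 1)" by (simp add: abs_mult distrib_left)
        moreover have "blinfun_apply \<Psi> ((c *\<^sub>R f) o\<^sub>L T) - blinfun_apply \<Psi> ((c *\<^sub>R f) o\<^sub>L ?T0) = c * ?d"
          by (simp add: bounded_bilinear.scaleR_left[OF comp] blinfun.scaleR_right right_diff_distrib)
        ultimately show
          "\<bar>blinfun_apply \<Psi> ((c *\<^sub>R f) o\<^sub>L T) - blinfun_apply \<Psi> ((c *\<^sub>R f) o\<^sub>L ?T0)\<bar> < \<epsilon>"
          by linarith
      qed (use nearD(1,2)[OF U] in auto)
      then show "\<exists>U. near (c *\<^sub>R f) \<epsilon> U" by blast
    qed
  qed
  moreover have "{f :: ('y \<Rightarrow>\<^sub>L real) \<Rightarrow>\<^sub>L real. norm f \<le> 1 \<and> blinfun_apply f y0 = 1} \<subseteq> G"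
    unfolding G_def
  proof (intro subsetI CollectI allI impI)
    fix f :: "('y \<Rightarrow>\<^sub>L real) \<Rightarrow>\<^sub>L real" and \<epsilon> :: real
    assume "f \<in> {f. norm f \<le> 1 \<and> blinfun_apply f y0 = 1}" "\<epsilon> > 0"
    then have f: "norm f \<le> 1" "blinfun_apply f y0 = 1" by auto
    obtain y where y: "f = bidual_embedding y"
      using refl unfolding reflexive_space_def by (metis surjE)
    have fT0: "f o\<^sub>L ?T0 = x0" by (simp add: compose_rank_one f)
    obtain U where U: "openin weak_star_topology U" "x0 \<in> U"
      "\<And>g. g \<in> U \<Longrightarrow> norm g \<le> 1 \<Longrightarrow> \<bar>blinfun_apply \<Psi> g - blinfun_apply \<Psi> x0\<bar> < \<epsilon>"
      using x0 \<open>\<epsilon> > 0\<close> unfolding namioka_point_iff[OF topspace_weak_star_topology] by blast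
    define V where "V = {T :: 'x \<Rightarrow>\<^sub>L 'y \<Rightarrow>\<^sub>L real. f o\<^sub>L T \<in> U}"
    have "openin operator_weak_star_topology V"
      using openin_continuous_map_preimage[OF continuous_map_compose_evaluation[of y] U(1)]
      by (simp add: V_def y topspace_operator_weak_star_topology)
    moreover have "norm (f o\<^sub>L T) \<le> 1" if "norm T \<le> 1" for T :: "'x \<Rightarrow>\<^sub>L 'y \<Rightarrow>\<^sub>L real"
      using norm_blinfun_compose[of f T] mult_mono[OF f(1) that] by simp
    ultimately have "near f \<epsilon> V"
      using U(2,3) by (intro nearI) (simp_all add: V_def fT0)
    then show "\<exists>V. near f \<epsilon> V" by blast
  qed
  ultimately have "span {f :: ('y \<Rightarrow>\<^sub>L real) \<Rightarrow>\<^sub>L real. norm f \<le> 1 \<and> blinfun_apply f y0 = 1} \<subseteq> G"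
    using span_minimal by blast
  then have "f \<in> G" using \<open>unitary y0\<close> by (auto simp: unitary_def)
  then show ?thesis using \<open>\<epsilon> > 0\<close> by (simp add: G_def near_def)
qed

theorem theorem2p4:
  fixes x0 :: "'x::banach \<Rightarrow>\<^sub>L real" and y0 :: "'y::banach \<Rightarrow>\<^sub>L real"
  assumes "reflexive_space TYPE('y)"
    and "approximation_property TYPE('y)"
    and "norm y0 = 1" and "unitary y0"
    and "\<forall>T :: 'x \<Rightarrow>\<^sub>L 'y \<Rightarrow>\<^sub>L real. compact_operator T"
    and "norm x0 = 1" and "namioka_point weak_star_topology x0"
  shows "norm (rank_one x0 y0) = 1 \<and>
    namioka_point (operator_weak_star_topology :: ('x \<Rightarrow>\<^sub>L 'y \<Rightarrow>\<^sub>L real) topology)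
      (rank_one x0 y0)"
proof
  show norm: "norm (rank_one x0 y0) = 1" using assms by (simp add: norm_rank_one)
  show "namioka_point (operator_weak_star_topology :: ('x \<Rightarrow>\<^sub>L 'y \<Rightarrow>\<^sub>L real) topology) (rank_one x0 y0)"
  proof (rule namioka_pointI_compact_operators[OF topspace_operator_weak_star_topology _
        reflexive_dual[OF assms(1)]])
    show "norm (rank_one x0 y0) \<le> 1" using norm by simp
    show "compact_operator T" for T :: "'x \<Rightarrow>\<^sub>L 'y \<Rightarrow>\<^sub>L real" using assms(5) by blast
  qed (rule rank_one_unitary_nhds[OF assms(1,4,7)])
qed

end
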